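(* Given simplicial (non-metric) $G$-trees $T,T'$ in the same deformation space, the following conditions are equivalent: (1) There exist morphisms $f:T\to T'$ and $f':T'\to T$. (2) $T$ and $T'$ have the same generalized edge groups. (3) $T$ and $T'$ have the same bi-elliptic groups. These conditions are satisfied if $T$ and $T'$ are reduced.
   Context: $G$ is a finitely generated group. A $G$-tree is a simplicial tree $T$ with an action of $G$ by simplicial automorphisms without inversions, always assumed minimal (no proper $G$-invariant subtree). $G_v,G_e$ denote vertex and edge stabilizers. A subgroup of $G$ is elliptic in $T$ if it fixes a point of $T$. Two $G$-trees are in the same deformation space if they have the same elliptic subgroups. $T$ is reduced if, whenever an edge $e=vw$ satisfies $G_e=G_v$, the vertices $v$ and $w$ are in the same $G$-orbit. A subgroup $H$ is bi-elliptic in $T$ if it is contained in some edge stabilizer $G_e$ of $T$. It is a generalized edge group of $T$ if $G_e\subset H\subset G_{e'}$ for some edges $e,e'$ of $T$. Maps between $G$-trees are always $G$-equivariant. A map between $G$-trees is simplicial if each edge is mapped bijectively onto an edge. A map $f:T\to T'$ is a morphism if each edge of $T$ can be written as a finite union of subsegments, each of which is mapped bijectively onto a segment of $T'$; equivalently, one may subdivide $T$ and $T'$ so that $f$ becomes simplicial. *)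

theory Defs
  imports
    "HOL-Algebra.Group_Action"
    "HOL-Algebra.Generated_Groups"
    "HOL-Analysis.Function_Topology"
    "HOL-Analysis.Path_Connected"
begin

definition finitely_generated_group :: "('a, 'm) monoid_scheme \<Rightarrow> bool" where
  "finitely_generated_group G \<longleftrightarrow>
     group G \<and> (\<exists>S. finite S \<and> S \<subseteq> carrier G \<and> generate G S = carrier G)"

text \<open>A simplicial tree is a nonempty connected graph without circuits. A circuit is a list of at
  least three distinct vertices, consecutive ones being adjacent, as are the last and the first.\<close>

definition simplicial_tree :: "'v set \<Rightarrow> 'v set set \<Rightarrow> bool" where
  "simplicial_tree V E \<longleftrightarrow>
     V \<noteq> {} \<and>
     (\<forall>e\<in>E. \<exists>u\<in>V. \<exists>v\<in>V. u \<noteq> v \<and> e = {u, v}) \<and>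
     (\<forall>u\<in>V. \<forall>v\<in>V. (u, v) \<in> {(x, y). {x, y} \<in> E}\<^sup>*) \<and>
     \<not> (\<exists>p. 3 \<le> length p \<and> distinct p \<and>
           successively (\<lambda>x y. {x, y} \<in> E) p \<and> {last p, hd p} \<in> E)"

record ('a, 'v) gtree =
  verts :: "'v set"
  edges :: "'v set set"
  act :: "'a \<Rightarrow> 'v \<Rightarrow> 'v"

definition minimal_gtree :: "('a, 'm) monoid_scheme \<Rightarrow> ('a, 'v) gtree \<Rightarrow> bool" where
  "minimal_gtree G T \<longleftrightarrow>
     (\<forall>W F. W \<subseteq> verts T \<and> F \<subseteq> edges T \<and> simplicial_tree W F \<and>
        (\<forall>g\<in>carrier G. \<forall>w\<in>W. act T g w \<in> W) \<and>
        (\<forall>g\<in>carrier G. \<forall>e\<in>F. act T g ` e \<in> F)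
        \<longrightarrow> W = verts T \<and> F = edges T)"

definition gtree :: "('a, 'm) monoid_scheme \<Rightarrow> ('a, 'v) gtree \<Rightarrow> bool" where
  "gtree G T \<longleftrightarrow>
     simplicial_tree (verts T) (edges T) \<and>
     group_action G (verts T) (act T) \<and>
     (\<forall>g\<in>carrier G. \<forall>e\<in>edges T. act T g ` e \<in> edges T) \<and>
     (\<forall>g\<in>carrier G. \<forall>u v. {u, v} \<in> edges T \<longrightarrow> \<not> (act T g u = v \<and> act T g v = u)) \<and>
     minimal_gtree G T"

text \<open>The realization in barycentric coordinates: a point is a function on the vertices which is
  nonnegative, has sum 1, and whose support is a vertex or an edge. It carries the topology of
  pointwise convergence. On a finite subcomplex this agrees with the usual topology of the
  complex; globally it is the topology of the simplicial metric. Hence arcs in the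
  realization are exactly the nondegenerate segments.\<close>

definition realization :: "('a, 'v) gtree \<Rightarrow> ('v \<Rightarrow> real) set" where
  "realization T =
     {x. (\<forall>v. 0 \<le> x v) \<and>
         {v. x v \<noteq> 0} \<in> (\<lambda>v. {v}) ` verts T \<union> edges T \<and>
         (\<Sum>v\<in>{v. x v \<noteq> 0}. x v) = 1}"

definition closed_edge :: "('a, 'v) gtree \<Rightarrow> 'v set \<Rightarrow> ('v \<Rightarrow> real) set" where
  "closed_edge T e = {x \<in> realization T. {v. x v \<noteq> 0} \<subseteq> e}"

text \<open>The affine extension of the action: the coordinate of \<open>g x\<close> at \<open>v\<close> is that of \<open>x\<close> at
  \<open>g\<inverse> v\<close>.\<close>

definition point_act ::
    "('a, 'm) monoid_scheme \<Rightarrow> ('a, 'v) gtree \<Rightarrow> 'a \<Rightarrow> ('v \<Rightarrow> real) \<Rightarrow> ('v \<Rightarrow> real)" where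
  "point_act G T g x = (\<lambda>v. if v \<in> verts T then x (act T (inv\<^bsub>G\<^esub> g) v) else 0)"

definition segment_in :: "('v \<Rightarrow> real) set \<Rightarrow> ('v \<Rightarrow> real) set \<Rightarrow> bool" where
  "segment_in X S \<longleftrightarrow> (\<exists>\<gamma>. arc \<gamma> \<and> path_image \<gamma> = S \<and> S \<subseteq> X)"

text \<open>Vertices may be mapped into the interior of edges. Continuity is required on each
  closed edge, that is, for the weak topology of the complex.\<close>

definition tree_morphism ::
    "('a, 'm) monoid_scheme \<Rightarrow> ('a, 'v) gtree \<Rightarrow> ('a, 'w) gtree \<Rightarrow>
     (('v \<Rightarrow> real) \<Rightarrow> ('w \<Rightarrow> real)) \<Rightarrow> bool" where
  "tree_morphism G T T' f \<longleftrightarrow>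
     f \<in> realization T \<rightarrow> realization T' \<and>
     (\<forall>g\<in>carrier G. \<forall>x\<in>realization T. f (point_act G T g x) = point_act G T' g (f x)) \<and>
     (\<forall>e\<in>edges T. continuous_on (closed_edge T e) f) \<and>
     (\<forall>e\<in>edges T. \<exists>\<S>. finite \<S> \<and> \<Union>\<S> = closed_edge T e \<and>
        (\<forall>S\<in>\<S>. segment_in (closed_edge T e) S \<and>
                inj_on f S \<and> segment_in (realization T') (f ` S)))"

abbreviation vertex_stabilizer ::
    "('a, 'm) monoid_scheme \<Rightarrow> ('a, 'v) gtree \<Rightarrow> 'v \<Rightarrow> 'a set" where
  "vertex_stabilizer G T v \<equiv> stabilizer G (act T) v"

text \<open>The setwise stabilizer of an edge; in the absence of inversions it fixes the edge
  pointwise.\<close>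

abbreviation edge_stabilizer ::
    "('a, 'm) monoid_scheme \<Rightarrow> ('a, 'v) gtree \<Rightarrow> 'v set \<Rightarrow> 'a set" where
  "edge_stabilizer G T e \<equiv> stabilizer G (\<lambda>g. (`) (act T g)) e"

definition elliptic :: "('a, 'm) monoid_scheme \<Rightarrow> ('a, 'v) gtree \<Rightarrow> 'a set \<Rightarrow> bool" where
  "elliptic G T H \<longleftrightarrow>
     subgroup H G \<and> (\<exists>x\<in>realization T. \<forall>h\<in>H. point_act G T h x = x)"

definition same_deformation_space ::
    "('a, 'm) monoid_scheme \<Rightarrow> ('a, 'v) gtree \<Rightarrow> ('a, 'w) gtree \<Rightarrow> bool" where
  "same_deformation_space G T T' \<longleftrightarrow> (\<forall>H. elliptic G T H \<longleftrightarrow> elliptic G T' H)"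

definition reduced :: "('a, 'm) monoid_scheme \<Rightarrow> ('a, 'v) gtree \<Rightarrow> bool" where
  "reduced G T \<longleftrightarrow>
     (\<forall>v w. {v, w} \<in> edges T \<and> edge_stabilizer G T {v, w} = vertex_stabilizer G T v
        \<longrightarrow> w \<in> orbit G (act T) v)"

definition bi_elliptic :: "('a, 'm) monoid_scheme \<Rightarrow> ('a, 'v) gtree \<Rightarrow> 'a set \<Rightarrow> bool" where
  "bi_elliptic G T H \<longleftrightarrow> subgroup H G \<and> (\<exists>e\<in>edges T. H \<subseteq> edge_stabilizer G T e)"

definition generalized_edge_group ::
    "('a, 'm) monoid_scheme \<Rightarrow> ('a, 'v) gtree \<Rightarrow> 'a set \<Rightarrow> bool" where
  "generalized_edge_group G T H \<longleftrightarrow>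
     subgroup H G \<and>
     (\<exists>e\<in>edges T. \<exists>e'\<in>edges T. edge_stabilizer G T e \<subseteq> H \<and> H \<subseteq> edge_stabilizer G T e')"

definition morphisms_both_ways ::
    "('a, 'm) monoid_scheme \<Rightarrow> ('a, 'v) gtree \<Rightarrow> ('a, 'w) gtree \<Rightarrow> bool" where
  "morphisms_both_ways G T T' \<longleftrightarrow>
     (\<exists>f. tree_morphism G T T' f) \<and> (\<exists>f'. tree_morphism G T' T f')"

definition same_generalized_edge_groups ::
    "('a, 'm) monoid_scheme \<Rightarrow> ('a, 'v) gtree \<Rightarrow> ('a, 'w) gtree \<Rightarrow> bool" where
  "same_generalized_edge_groups G T T' \<longleftrightarrow>
     (\<forall>H. generalized_edge_group G T H \<longleftrightarrow> generalized_edge_group G T' H)"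

definition same_bi_elliptic_groups ::
    "('a, 'm) monoid_scheme \<Rightarrow> ('a, 'v) gtree \<Rightarrow> ('a, 'w) gtree \<Rightarrow> bool" where
  "same_bi_elliptic_groups G T T' \<longleftrightarrow>
     (\<forall>H. bi_elliptic G T H \<longleftrightarrow> bi_elliptic G T' H)"

end

theory Submission
  imports Defs
begin

text \<open>All three conditions say that every edge stabilizer of either tree is contained in an edge
  stabilizer of the other.

  A morphism maps a point of an edge \<open>e\<close> into the interior of an edge, which \<open>G\<^sub>e\<close> then fixes.
  Conversely, an equivariant map on vertices exists because vertex stabilizers are elliptic; it
  extends over an edge \<open>e\<close> along a geodesic or, if the ends of \<open>e\<close> have the same image, by going back
  and forth along an edge fixed by \<open>G\<^sub>e\<close>. For generalized edge groups one uses that every edge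
  stabilizer of one tree contains one of the other: by minimality each edge lies on the
  geodesic joining the images of two adjacent vertices.\<close>

section \<open>Geodesics in simplicial trees\<close>

text \<open>The argument splits into one-way statements. Given an equivariant vertex map from
  \<open>T\<close> to \<open>T'\<close>, a morphism from \<open>T\<close> to \<open>T'\<close>
  exists exactly when every edge stabilizer of \<open>T\<close> lies in one of \<open>T'\<close>,
  and the same containments carry bi-elliptic groups from \<open>T\<close> to \<open>T'\<close>. The
  obstacle is that a vertex map may identify the ends of an edge, which a morphism may not collapse;
  the containment provides a fixed edge at the common image along which to fold. Choices are made
  once per orbit, so whatever is chosen for an edge must be fixed by its stabilizer; the absence of
  inversions makes this possible for its orientation as well. The lower bound of a generalized edge
  group travels against the vertex map: a map from \<open>T\<close> to \<open>T'\<close> places an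
  edge stabilizer of \<open>T\<close> inside each one of \<open>T'\<close>.\<close>

definition vertex_path :: "'v set set \<Rightarrow> 'v \<Rightarrow> 'v list \<Rightarrow> 'v \<Rightarrow> bool" where
  "vertex_path E u p v \<longleftrightarrow>
     p \<noteq> [] \<and> hd p = u \<and> last p = v \<and> distinct p \<and> successively (\<lambda>x y. {x, y} \<in> E) p"

definition geodesic :: "'v set set \<Rightarrow> 'v \<Rightarrow> 'v \<Rightarrow> 'v list" where
  "geodesic E u v = (THE p. vertex_path E u p v)"

lemma vertex_path_exists:
  assumes "(u, v) \<in> {(x, y). {x, y} \<in> E}\<^sup>*"
  shows "\<exists>p. vertex_path E u p v"
  using assms
proof (induction rule: converse_rtrancl_induct)
  case base
  have "vertex_path E v [v] v" by (simp add: vertex_path_def)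
  then show ?case by blast
next
  case (step u w)
  then obtain p where p: "vertex_path E w p v" by blast
  show ?case
  proof (cases "u \<in> set p")
    case True
    then obtain xs ys where "p = xs @ u # ys" by (meson split_list)
    with p have "vertex_path E u (u # ys) v"
      by (auto simp: vertex_path_def successively_append_iff)
    then show ?thesis by blast
  next
    case False
    with p step have "vertex_path E u (u # p) v"
      by (auto simp: vertex_path_def successively_Cons)
    then show ?thesis by blast
  qed
qed

lemma vertex_path_unique:
  assumes acyclic: "\<not> (\<exists>p. 3 \<le> length p \<and> distinct p \<and>
      successively (\<lambda>x y. {x, y} \<in> E) p \<and> {last p, hd p} \<in> E)"
    and "vertex_path E u p v" and "vertex_path E u q v"
  shows "p = q"
  using assms(2,3)
proof (induction p arbitrary: u q)
  case Nil
  then show ?case by (simp add: vertex_path_def)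
next
  case (Cons a p)
  then have [simp]: "a = u" by (simp add: vertex_path_def)
  from Cons.prems(2) obtain q' where q: "q = u # q'"
    by (cases q) (auto simp: vertex_path_def)
  consider "p = [] \<or> q' = []" | "p \<noteq> []" "q' \<noteq> []" "hd p = hd q'" | "p \<noteq> []" "q' \<noteq> []" "hd p \<noteq> hd q'"
    by blast
  then show ?case
  proof cases
    case 1
    then have "p = []" "q' = []"
      using Cons.prems q by (auto simp: vertex_path_def split: if_splits)
    then show ?thesis using q by simp
  next
    case 2
    then have "vertex_path E (hd p) p v" "vertex_path E (hd p) q' v"
      using Cons.prems q by (auto simp: vertex_path_def successively_Cons)
    from Cons.IH[OF this] show ?thesis using q by simp
  next
    case 3
    have "last p = v" "last q' = v"
      using Cons.prems q 3 by (auto simp: vertex_path_def)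
    then have "\<exists>x\<in>set p. x \<in> set q'" using 3 last_in_set by metis
    then obtain xs z zs where p: "p = xs @ z # zs" and z: "z \<in> set q'" and xs: "\<forall>y\<in>set xs. y \<notin> set q'"
      using split_list_first_prop[of p "\<lambda>x. x \<in> set q'"] by blast
    from z obtain ys ws where q': "q' = ys @ z # ws" by (meson split_list)
    \<comment> \<open>Follow \<open>p\<close> up to its first vertex \<open>z\<close> on
      \<open>q'\<close> and return along \<open>q'\<close>. Taking the first such vertex keeps the
      vertices distinct; since the paths leave \<open>u\<close> differently, \<open>xs\<close> and
      \<open>ys\<close> are not both empty, which gives the third vertex of the circuit.\<close>
    let ?c = "u # xs @ z # rev ys"
    have "3 \<le> length ?c" using 3 p q' by (cases xs; cases ys) auto
    moreover have "distinct ?c" using Cons.prems p q q' xs by (auto simp: vertex_path_def)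
    moreover have "successively (\<lambda>x y. {x, y} \<in> E) ?c"
      using Cons.prems p q q'
      by (auto simp: vertex_path_def successively_append_iff successively_Cons insert_commute hd_append
          last_rev hd_rev split: if_splits)
    moreover have "{last ?c, hd ?c} \<in> E"
      using Cons.prems p q q'
      by (cases ys) (auto simp: vertex_path_def insert_commute successively_Cons)
    ultimately show ?thesis using acyclic by blast
  qed
qed

locale tree =
  fixes V :: "'v set" and E :: "'v set set"
  assumes tree: "simplicial_tree V E"
begin

lemma edge_verts: "{u, v} \<in> E \<Longrightarrow> u \<in> V \<and> v \<in> V \<and> u \<noteq> v"
  using tree unfolding simplicial_tree_def by (metis doubleton_eq_iff insert_absorb2)

lemma edgeE:
  assumes "e \<in> E"
  obtains u v where "e = {u, v}" "u \<in> V" "v \<in> V" "u \<noteq> v"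
  using assms tree unfolding simplicial_tree_def by metis

lemma geodesicI: "vertex_path E u p v \<Longrightarrow> geodesic E u v = p"
  unfolding geodesic_def
  using tree unfolding simplicial_tree_def
  by (metis (mono_tags, lifting) vertex_path_unique the_equality)

lemma vertex_path_geodesic:
  assumes "u \<in> V" "v \<in> V"
  shows "vertex_path E u (geodesic E u v) v"
proof -
  have "(u, v) \<in> {(x, y). {x, y} \<in> E}\<^sup>*" using tree assms unfolding simplicial_tree_def by blast
  then obtain p where "vertex_path E u p v" using vertex_path_exists by metis
  then show ?thesis using geodesicI by metis
qed

lemma walk_subset:
  assumes "successively (\<lambda>x y. {x, y} \<in> E) p" "hd p \<in> V"
  shows "set p \<subseteq> V"
  using assms by (induction p) (auto simp: successively_Cons dest: edge_verts)

text \<open>One of the two geodesics is a proper tail of the other: either \<open>w\<close> lies on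
  the geodesic from \<open>v\<close>, or prepending \<open>w\<close> to it gives the geodesic from
  \<open>w\<close>. In particular no group element fixing \<open>u\<close> can exchange the two
  distances.\<close>

lemma geodesic_neighbour_cases:
  assumes e: "{v, w} \<in> E" and u: "u \<in> V"
  shows "w \<in> set (geodesic E v u) \<or> v \<in> set (geodesic E w u)"
    and "length (geodesic E v u) \<noteq> length (geodesic E w u)"
proof -
  have vw: "v \<in> V" "w \<in> V" "v \<noteq> w" using edge_verts[OF e] by auto
  note gv = vertex_path_geodesic[OF vw(1) u]
  have "w \<in> set (geodesic E v u) \<and> length (geodesic E w u) < length (geodesic E v u) \<or>
    v \<in> set (geodesic E w u) \<and> length (geodesic E v u) < length (geodesic E w u)"
  proof (cases "w \<in> set (geodesic E v u)")
    case True
    then obtain xs ys where p: "geodesic E v u = xs @ w # ys" by (meson split_list)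
    with gv have "vertex_path E w (w # ys) u" "xs \<noteq> []"
      using vw by (auto simp: vertex_path_def successively_append_iff)
    then show ?thesis using True p geodesicI by fastforce
  next
    case False
    with gv have "vertex_path E w (w # geodesic E v u) u"
      using e by (auto simp: vertex_path_def successively_Cons insert_commute)
    then have "geodesic E w u = w # geodesic E v u" by (rule geodesicI)
    moreover have "v \<in> set (geodesic E v u)"
      using gv by (metis vertex_path_def hd_in_set)
    ultimately show ?thesis by simp
  qed
  then show "w \<in> set (geodesic E v u) \<or> v \<in> set (geodesic E w u)"
    and "length (geodesic E v u) \<noteq> length (geodesic E w u)" by auto
qed

end

section \<open>Groups acting on trees\<close>

text \<open>A value chosen at an orbit representative and fixed by its stabilizer can be transported
  along the orbit without ambiguity. The relation \<open>R\<close> describes admissible values;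
  \<open>\<beta>\<close> is multiplicative only on these, because a tree action is controlled only
  on vertices of the tree. The lemma serves both for vertex maps and for walks assigned to
  edges.\<close>

lemma (in group) equivariant_choice:
  fixes \<alpha> :: "'a \<Rightarrow> 'x \<Rightarrow> 'x" and \<beta> :: "'a \<Rightarrow> 'y \<Rightarrow> 'y"
  assumes closed: "\<And>g x. g \<in> carrier G \<Longrightarrow> x \<in> X \<Longrightarrow> \<alpha> g x \<in> X"
    and one: "\<And>x. x \<in> X \<Longrightarrow> \<alpha> \<one> x = x"
    and mult: "\<And>g h x. g \<in> carrier G \<Longrightarrow> h \<in> carrier G \<Longrightarrow> x \<in> X \<Longrightarrow> \<alpha> (g \<otimes> h) x = \<alpha> g (\<alpha> h x)"
    and R: "\<And>g x y. g \<in> carrier G \<Longrightarrow> x \<in> X \<Longrightarrow> R x y \<Longrightarrow> R (\<alpha> g x) (\<beta> g y)"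
    and multR: "\<And>g h x y. g \<in> carrier G \<Longrightarrow> h \<in> carrier G \<Longrightarrow> x \<in> X \<Longrightarrow> R x y \<Longrightarrow>
      \<beta> (g \<otimes> h) y = \<beta> g (\<beta> h y)"
    and ex: "\<And>x. x \<in> X \<Longrightarrow> \<exists>y. R x y \<and> (\<forall>g\<in>carrier G. \<alpha> g x = x \<longrightarrow> \<beta> g y = y)"
  shows "\<exists>s. \<forall>x\<in>X. R x (s x) \<and> (\<forall>g\<in>carrier G. s (\<alpha> g x) = \<beta> g (s x))"
proof -
  define orb where "orb x = {\<alpha> g x | g. g \<in> carrier G}" for x
  \<comment> \<open>The choice depends only on the orbit as a set, so \<open>x\<close> and its
    translates receive the same representative.\<close>
  define r where "r x = (SOME y. y \<in> orb x)" for x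
  have orb_act: "orb (\<alpha> g x) = orb x" if "g \<in> carrier G" "x \<in> X" for g x
  proof
    show "orb (\<alpha> g x) \<subseteq> orb x"
      using that unfolding orb_def by (auto simp flip: mult)
    show "orb x \<subseteq> orb (\<alpha> g x)"
    proof
      fix y assume "y \<in> orb x"
      then obtain h where h: "h \<in> carrier G" "y = \<alpha> h x" unfolding orb_def by blast
      have "\<alpha> (h \<otimes> inv g) (\<alpha> g x) = \<alpha> ((h \<otimes> inv g) \<otimes> g) x"
        using that h by (subst mult) auto
      also have "\<dots> = y" using that h by (simp add: m_assoc)
      finally show "y \<in> orb (\<alpha> g x)"
        using that h unfolding orb_def by (metis (mono_tags, lifting) inv_closed m_closed mem_Collect_eq)
    qed
  qed
  have r_orb: "r x \<in> orb x" if "x \<in> X" for x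
  proof -
    have "\<alpha> \<one> x \<in> orb x" unfolding orb_def by blast
    then show ?thesis unfolding r_def by (rule someI)
  qed
  have "\<forall>x\<in>X. \<exists>y. R x y \<and> (\<forall>g\<in>carrier G. \<alpha> g x = x \<longrightarrow> \<beta> g y = y)" using ex by blast
  then obtain c where c_both: "\<forall>x\<in>X. R x (c x) \<and> (\<forall>g\<in>carrier G. \<alpha> g x = x \<longrightarrow> \<beta> g (c x) = c x)"
    by (rule bchoice[THEN exE])
  then have c: "\<And>x. x \<in> X \<Longrightarrow> R x (c x)"
    "\<And>x g. x \<in> X \<Longrightarrow> g \<in> carrier G \<Longrightarrow> \<alpha> g x = x \<Longrightarrow> \<beta> g (c x) = c x" by blast+
  have rX: "r x \<in> X" if "x \<in> X" for x
    using r_orb[OF that] closed that unfolding orb_def by auto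
  have "\<exists>g. g \<in> carrier G \<and> \<alpha> g (r x) = x" if "x \<in> X" for x
  proof -
    obtain g where g: "g \<in> carrier G" "r x = \<alpha> g x" using r_orb[OF \<open>x \<in> X\<close>] unfolding orb_def by auto
    then have "\<alpha> (inv g) (r x) = x" using that by (simp flip: mult add: one)
    then show ?thesis using g by blast
  qed
  then obtain t where t: "\<And>x. x \<in> X \<Longrightarrow> t x \<in> carrier G \<and> \<alpha> (t x) (r x) = x" by metis
  define s where "s x = \<beta> (t x) (c (r x))" for x
  have "R x (s x)" if "x \<in> X" for x
    using R[OF _ rX c(1)[OF rX]] t that unfolding s_def by metis
  moreover have "s (\<alpha> g x) = \<beta> g (s x)" if x: "x \<in> X" and g: "g \<in> carrier G" for x g
  proof -
    \<comment> \<open>Both \<open>?h\<close> and \<open>?k\<close> carry the representative to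
      \<open>\<alpha> g x\<close>. They differ by an element of its stabilizer, which fixes
      \<open>?y\<close>.\<close>
    let ?h = "t (\<alpha> g x)" and ?k = "g \<otimes> t x" and ?y = "c (r x)"
    have r_eq: "r (\<alpha> g x) = r x" unfolding r_def using orb_act x g by simp
    have car: "?h \<in> carrier G" "t x \<in> carrier G" "?k \<in> carrier G" using t x g closed by auto
    have h: "\<alpha> ?h (r x) = \<alpha> g x" using t[OF closed[OF g x]] r_eq by simp
    have k: "\<alpha> ?k (r x) = \<alpha> g x" using t[OF x] g rX[OF x] by (simp add: mult)
    have "\<alpha> (inv ?h \<otimes> ?k) (r x) = \<alpha> (inv ?h) (\<alpha> ?h (r x))"
      using car rX[OF x] h k by (simp only: mult inv_closed)
    also have "\<dots> = \<alpha> (inv ?h \<otimes> ?h) (r x)" using car rX[OF x] by (simp only: mult inv_closed)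
    also have "\<dots> = r x" using car rX[OF x] by (simp add: one)
    finally have fix_y: "\<beta> (inv ?h \<otimes> ?k) ?y = ?y" using c(2) rX[OF x] car by simp
    have "\<beta> ?k ?y = \<beta> (?h \<otimes> (inv ?h \<otimes> ?k)) ?y"
      using car by (simp add: m_assoc[symmetric])
    also have "\<dots> = \<beta> ?h ?y"
      using multR[OF car(1) _ rX[OF x] c(1)[OF rX[OF x]], of "inv ?h \<otimes> ?k"] car fix_y by simp
    finally show ?thesis
      unfolding s_def r_eq using multR[OF g car(2) rX[OF x] c(1)[OF rX[OF x]]] by simp
  qed
  ultimately show ?thesis by blast
qed

definition vertex_point :: "'v \<Rightarrow> 'v \<Rightarrow> real" where
  "vertex_point v = indicator {v}"

lemma vertex_point_realization: "v \<in> verts T \<Longrightarrow> vertex_point v \<in> realization T"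
proof -
  have "{w. vertex_point v w \<noteq> 0} = {v}" by (auto simp: vertex_point_def indicator_def)
  moreover have "vertex_point v v = 1" by (simp add: vertex_point_def)
  ultimately show "v \<in> verts T \<Longrightarrow> vertex_point v \<in> realization T"
    by (auto simp: realization_def vertex_point_def)
qed

locale G_tree = group G for G :: "('a, 'm) monoid_scheme" (structure) +
  fixes T :: "('a, 'v) gtree"
  assumes gtree: "gtree G T"

sublocale G_tree \<subseteq> tree "verts T" "edges T"
  using gtree by unfold_locales (simp add: gtree_def)

context G_tree
begin

lemma action: "group_action G (verts T) (act T)"
  using gtree by (simp add: gtree_def)

lemma act_closed: "g \<in> carrier G \<Longrightarrow> v \<in> verts T \<Longrightarrow> act T g v \<in> verts T"
  using group_action.element_image[OF action] by blast

lemma act_mult: "g \<in> carrier G \<Longrightarrow> h \<in> carrier G \<Longrightarrow> v \<in> verts T \<Longrightarrow>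
    act T (g \<otimes> h) v = act T g (act T h v)"
  using group_action.composition_rule[OF action] by blast

lemma act_one: "v \<in> verts T \<Longrightarrow> act T \<one> v = v"
  using group_action.id_eq_one[OF action] by (metis restrict_apply)

lemma act_inv_act: "g \<in> carrier G \<Longrightarrow> v \<in> verts T \<Longrightarrow> act T (inv g) (act T g v) = v"
  by (simp flip: act_mult add: act_one)

lemma act_act_inv: "g \<in> carrier G \<Longrightarrow> v \<in> verts T \<Longrightarrow> act T g (act T (inv g) v) = v"
  by (simp flip: act_mult add: act_one)

lemma act_eq_iff: "g \<in> carrier G \<Longrightarrow> v \<in> verts T \<Longrightarrow> w \<in> verts T \<Longrightarrow>
    act T g v = act T g w \<longleftrightarrow> v = w"
  by (metis act_inv_act)

lemma act_edge: "g \<in> carrier G \<Longrightarrow> {u, v} \<in> edges T \<Longrightarrow> {act T g u, act T g v} \<in> edges T"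
  using gtree unfolding gtree_def by (metis image_empty image_insert)

lemma act_vertex_path:
  assumes g: "g \<in> carrier G" and p: "vertex_path (edges T) u p v" and u: "u \<in> verts T"
  shows "vertex_path (edges T) (act T g u) (map (act T g) p) (act T g v)"
proof -
  have V: "set p \<subseteq> verts T" using p u walk_subset by (auto simp: vertex_path_def)
  then have "inj_on (act T g) (set p)" using act_eq_iff[OF g] by (meson inj_onI subsetD)
  moreover have "successively (\<lambda>x y. {act T g x, act T g y} \<in> edges T) p"
    using p act_edge[OF g] by (auto simp: vertex_path_def elim: successively_mono)
  ultimately show ?thesis
    using p by (auto simp: vertex_path_def hd_map last_map distinct_map successively_map)
qed

lemma act_geodesic:
  assumes "g \<in> carrier G" "u \<in> verts T" "v \<in> verts T"
  shows "geodesic (edges T) (act T g u) (act T g v) = map (act T g) (geodesic (edges T) u v)"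
  using act_vertex_path vertex_path_geodesic geodesicI assms by metis

lemma geodesic_fixed:
  assumes "g \<in> carrier G" "u \<in> verts T" "v \<in> verts T" "act T g u = u" "act T g v = v"
    and "x \<in> set (geodesic (edges T) u v)"
  shows "act T g x = x"
  using act_geodesic[OF assms(1-3)] assms(4-6) by (metis list.map_id map_eq_conv id_apply)

lemma no_inversion:
  assumes "g \<in> carrier G" "{u, v} \<in> edges T" "act T g u \<in> {u, v}" "act T g v \<in> {u, v}"
  shows "act T g u = u \<and> act T g v = v"
proof -
  have "\<not> (act T g u = v \<and> act T g v = u)"
    using gtree assms(1,2) unfolding gtree_def by blast
  then show ?thesis using assms edge_verts[OF assms(2)] act_eq_iff[OF assms(1)] by blast
qed

lemma edge_stabilizer_eq:
  assumes "{u, v} \<in> edges T"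
  shows "edge_stabilizer G T {u, v} = {g \<in> carrier G. act T g u = u \<and> act T g v = v}"
proof -
  have "act T g u = u \<and> act T g v = v" if "g \<in> carrier G" "{act T g u, act T g v} = {u, v}" for g
    using no_inversion[OF that(1) assms] that(2) by blast
  then show ?thesis unfolding stabilizer_def by auto
qed

lemma fixator_subgroup:
  assumes "A \<subseteq> verts T"
  shows "subgroup {g \<in> carrier G. \<forall>v\<in>A. act T g v = v} G"
proof
  show "inv x \<in> {g \<in> carrier G. \<forall>v\<in>A. act T g v = v}"
    if "x \<in> {g \<in> carrier G. \<forall>v\<in>A. act T g v = v}" for x
    using that assms by (auto, metis act_inv_act subsetD)
qed (use assms in \<open>auto simp: act_mult act_one subset_iff\<close>)

lemma vertex_stabilizer_subgroup: "v \<in> verts T \<Longrightarrow> subgroup (vertex_stabilizer G T v) G"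
  using fixator_subgroup[of "{v}"] by (simp add: stabilizer_def)

lemma edge_stabilizer_subgroup:
  assumes "e \<in> edges T"
  shows "subgroup (edge_stabilizer G T e) G"
  using assms
proof (rule edgeE)
  fix u v assume "e = {u, v}" "u \<in> verts T" "v \<in> verts T"
  then show ?thesis
    using fixator_subgroup[of "{u, v}"] edge_stabilizer_eq assms by simp
qed

section \<open>Fixed points and elliptic subgroups\<close>

lemma support_cases:
  assumes "x \<in> realization T"
  obtains v where "v \<in> verts T" "{w. x w \<noteq> 0} = {v}"
  | u v where "{u, v} \<in> edges T" "u \<noteq> v" "{w. x w \<noteq> 0} = {u, v}"
proof -
  consider v where "v \<in> verts T" "{w. x w \<noteq> 0} = {v}" | "{w. x w \<noteq> 0} \<in> edges T"
    using assms unfolding realization_def by blast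
  then show thesis
  proof cases
    case 2
    then show thesis by (rule edgeE) (use 2 that(2) in simp)
  qed (rule that(1))
qed

lemma support_subset:
  assumes "x \<in> realization T"
  shows "{w. x w \<noteq> 0} \<subseteq> verts T"
  using assms by (rule support_cases) (auto dest: edge_verts)

text \<open>The support of a fixed point is mapped into itself; as it is a vertex or an edge that
  cannot be inverted, each of its vertices is fixed.\<close>

lemma fixed_support:
  assumes x: "x \<in> realization T" and g: "g \<in> carrier G"
    and fixed: "point_act G T g x = x" and v: "x v \<noteq> 0"
  shows "act T g v = v"
proof -
  have "x (act T g w) \<noteq> 0" if w: "x w \<noteq> 0" for w
  proof -
    have "w \<in> verts T" using support_subset[OF x] w by blast
    then have "point_act G T g x (act T g w) = x w"
      using g by (simp add: point_act_def act_closed act_inv_act)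
    then show ?thesis using fixed w by simp
  qed
  then have image: "act T g w \<in> {w. x w \<noteq> 0}" if "w \<in> {w. x w \<noteq> 0}" for w using that by simp
  from x show ?thesis
  proof (rule support_cases)
    fix u assume S: "{w. x w \<noteq> 0} = {u}"
    have "v \<in> {w. x w \<noteq> 0}" using v by simp
    then show ?thesis using image unfolding S by blast
  next
    fix u w assume e: "{u, w} \<in> edges T" and S: "{w. x w \<noteq> 0} = {u, w}"
    have "act T g u \<in> {u, w}" "act T g w \<in> {u, w}" using image unfolding S by blast+
    then have "act T g u = u \<and> act T g w = w" by (rule no_inversion[OF g e])
    moreover have "v \<in> {u, w}" using v unfolding S[symmetric] by simp
    ultimately show ?thesis by blast
  qed
qed

lemma point_act_vertex_point:
  assumes "g \<in> carrier G" "v \<in> verts T"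
  shows "point_act G T g (vertex_point v) = vertex_point (act T g v)"
  using assms
  by (auto simp: point_act_def vertex_point_def fun_eq_iff indicator_def act_inv_act act_act_inv act_closed)

text \<open>Fixing an interior point of an edge entails fixing both ends, so ellipticity can be
  tested on vertices. This is the form in which a stabilizer yields a value for a vertex
  map.\<close>

lemma elliptic_iff:
  "elliptic G T H \<longleftrightarrow> subgroup H G \<and> (\<exists>v\<in>verts T. \<forall>h\<in>H. act T h v = v)"
proof
  assume "elliptic G T H"
  then obtain x where H: "subgroup H G" and x: "x \<in> realization T" "\<forall>h\<in>H. point_act G T h x = x"
    by (auto simp: elliptic_def)
  have "{w. x w \<noteq> 0} \<noteq> {}" using x(1) by (rule support_cases) auto
  then obtain v where v: "x v \<noteq> 0" by blast
  then have "\<forall>h\<in>H. act T h v = v"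
    using x fixed_support subgroup.mem_carrier[OF H] by blast
  then show "subgroup H G \<and> (\<exists>v\<in>verts T. \<forall>h\<in>H. act T h v = v)"
    using H v support_subset[OF x(1)] by blast
next
  assume R: "subgroup H G \<and> (\<exists>v\<in>verts T. \<forall>h\<in>H. act T h v = v)"
  then obtain v where v: "v \<in> verts T" "\<forall>h\<in>H. act T h v = v" by blast
  then have "\<forall>h\<in>H. point_act G T h (vertex_point v) = vertex_point v"
    using R point_act_vertex_point subgroup.mem_carrier by metis
  then show "elliptic G T H" using R vertex_point_realization[OF v(1)] by (metis elliptic_def)
qed

lemma vertex_stabilizer_elliptic: "v \<in> verts T \<Longrightarrow> elliptic G T (vertex_stabilizer G T v)"
  using vertex_stabilizer_subgroup by (auto simp: elliptic_iff stabilizer_def)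

end

section \<open>Equivariant vertex maps\<close>

locale vertex_map = source: G_tree G T + target: G_tree G T'
  for G :: "('a, 'm) monoid_scheme" (structure)
    and T :: "('a, 'v) gtree" and T' :: "('a, 'w) gtree" +
  fixes \<phi> :: "'v \<Rightarrow> 'w"
  assumes map_verts: "v \<in> verts T \<Longrightarrow> \<phi> v \<in> verts T'"
    and map_act: "g \<in> carrier G \<Longrightarrow> v \<in> verts T \<Longrightarrow> \<phi> (act T g v) = act T' g (\<phi> v)"

lemma vertex_map_exists:
  fixes G (structure)
  assumes "G_tree G T" "G_tree G T'" "same_deformation_space G T T'"
  shows "\<exists>\<phi>. vertex_map G T T' \<phi>"
proof -
  interpret source: G_tree G T by fact
  interpret target: G_tree G T' by fact
  have "\<exists>s. \<forall>v\<in>verts T. s v \<in> verts T' \<and> (\<forall>g\<in>carrier G. s (act T g v) = act T' g (s v))"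
  proof (rule source.equivariant_choice)
    fix v assume "v \<in> verts T"
    then have "elliptic G T' (vertex_stabilizer G T v)"
      using assms(3) source.vertex_stabilizer_elliptic by (auto simp: same_deformation_space_def)
    then show "\<exists>w. w \<in> verts T' \<and> (\<forall>g\<in>carrier G. act T g v = v \<longrightarrow> act T' g w = w)"
      by (auto simp: target.elliptic_iff stabilizer_def)
  qed (simp_all add: source.act_closed source.act_one source.act_mult target.act_closed target.act_mult)
  then show ?thesis by (auto simp: vertex_map_def vertex_map_axioms_def assms)
qed

context vertex_map
begin

lemma map_fixed: "g \<in> carrier G \<Longrightarrow> v \<in> verts T \<Longrightarrow> act T g v = v \<Longrightarrow> act T' g (\<phi> v) = \<phi> v"
  by (metis map_act)

text \<open>The geodesics joining the images of adjacent vertices form an invariant subtree, so by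
  minimality they cover \<open>T'\<close>.\<close>

lemma edge_covered:
  assumes e: "e \<in> edges T'"
  shows "\<exists>a b. {a, b} \<in> edges T \<and> e \<subseteq> set (geodesic (edges T') (\<phi> a) (\<phi> b))"
proof -
  define \<gamma> where "\<gamma> a b = geodesic (edges T') (\<phi> a) (\<phi> b)" for a b
  define F where "F = {{x, y} | x y. \<exists>a b xs ys. {a, b} \<in> edges T \<and> \<gamma> a b = xs @ x # y # ys}"
  \<comment> \<open>If \<open>\<phi>\<close> identifies the ends of every edge, all these geodesics
    are single vertices and \<open>F\<close> is empty; adding the images keeps the subtree
    nonempty.\<close>
  define W where "W = \<phi> ` verts T \<union> \<Union> F"
  have FI: "{x, y} \<in> F" if "{a, b} \<in> edges T" "\<gamma> a b = xs @ x # y # ys" for a b xs x y ys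
    using that unfolding F_def by blast
  have path: "vertex_path (edges T') (\<phi> a) (\<gamma> a b) (\<phi> b)" if "{a, b} \<in> edges T" for a b
    unfolding \<gamma>_def using target.vertex_path_geodesic map_verts source.edge_verts[OF that] by blast
  have F: "F \<subseteq> edges T'"
    using path unfolding F_def by (fastforce simp: vertex_path_def successively_append_iff)
  have W: "W \<subseteq> verts T'"
  proof -
    have "e \<subseteq> verts T'" if "e \<in> F" for e
      using subsetD[OF F that] by (rule target.edgeE) auto
    then show ?thesis unfolding W_def using map_verts by auto
  qed
  \<comment> \<open>Connectivity inside \<open>F\<close>: each vertex of \<open>\<gamma> a b\<close>
    is reached from \<open>\<phi> a\<close>, and the connectedness of \<open>T\<close> links the
    images of all vertices.\<close>
  define R where "R = {(x, y). {x, y} \<in> F}\<^sup>*"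
  have R_sym: "(y, x) \<in> R" if "(x, y) \<in> R" for x y
  proof -
    have "sym {(x, y). {x, y} \<in> F}" by (auto simp: sym_def insert_commute)
    then show ?thesis using that sym_rtrancl unfolding R_def by (metis symD)
  qed
  have R_trans: "(x, z) \<in> R" if "(x, y) \<in> R" "(y, z) \<in> R" for x y z
    using that unfolding R_def by simp
  have R_path: "(\<phi> a, x) \<in> R" if ab: "{a, b} \<in> edges T" and "\<gamma> a b = xs @ x # ys" for a b xs x ys
    using that(2)
  proof (induction xs arbitrary: x ys rule: rev_induct)
    case Nil
    then have "x = \<phi> a" using path[OF ab] by (simp add: vertex_path_def)
    then show ?case by (simp add: R_def)
  next
    case (snoc z xs)
    then have "(\<phi> a, z) \<in> R" by simp
    moreover have "{z, x} \<in> F" using FI[OF ab, of xs z x ys] snoc.prems by simp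
    then have "(z, x) \<in> R" unfolding R_def by auto
    ultimately show ?case by (rule R_trans)
  qed
  have R_image: "(\<phi> a, \<phi> b) \<in> R" if "a \<in> verts T" "b \<in> verts T" for a b
  proof -
    have "(a, b) \<in> {(x, y). {x, y} \<in> edges T}\<^sup>*"
      using source.tree that unfolding simplicial_tree_def by blast
    then show ?thesis
    proof (induction rule: rtrancl_induct)
      case base
      show ?case by (simp add: R_def)
    next
      case (step b c)
      then have bc: "{b, c} \<in> edges T" by simp
      have "\<gamma> b c = butlast (\<gamma> b c) @ \<phi> c # []"
        using path[OF bc] unfolding vertex_path_def by (metis append_butlast_last_id)
      then show ?case using step R_path[OF bc] R_trans by metis
    qed
  qed
  have R_W: "\<exists>a\<in>verts T. (\<phi> a, x) \<in> R" if "x \<in> W" for x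
  proof (cases "x \<in> \<phi> ` verts T")
    case True
    then show ?thesis by (auto simp: R_def)
  next
    case False
    then obtain y z a b xs ys where "x = y \<or> x = z" "{a, b} \<in> edges T" "\<gamma> a b = xs @ y # z # ys"
      using \<open>x \<in> W\<close> unfolding W_def F_def by blast
    then have "(\<phi> a, x) \<in> R" using R_path[of a b xs y "z # ys"] R_path[of a b "xs @ [y]" z ys] by auto
    then show ?thesis using source.edge_verts \<open>{a, b} \<in> edges T\<close> by blast
  qed
  have tree_F: "simplicial_tree W F"
    unfolding simplicial_tree_def
  proof (intro conjI)
    show "W \<noteq> {}" using source.tree unfolding W_def simplicial_tree_def by auto
    show "\<forall>e\<in>F. \<exists>u\<in>W. \<exists>v\<in>W. u \<noteq> v \<and> e = {u, v}"
    proof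
      fix e assume eF: "e \<in> F"
      then obtain u v where "e = {u, v}" "u \<noteq> v" using F by (metis subsetD target.edgeE)
      then show "\<exists>u\<in>W. \<exists>v\<in>W. u \<noteq> v \<and> e = {u, v}" using eF unfolding W_def by blast
    qed
    show "\<forall>u\<in>W. \<forall>v\<in>W. (u, v) \<in> {(x, y). {x, y} \<in> F}\<^sup>*"
      using R_W R_sym R_trans R_image unfolding R_def by metis
    show "\<not> (\<exists>p. 3 \<le> length p \<and> distinct p \<and>
           successively (\<lambda>x y. {x, y} \<in> F) p \<and> {last p, hd p} \<in> F)"
    proof
      assume "\<exists>p. 3 \<le> length p \<and> distinct p \<and>
           successively (\<lambda>x y. {x, y} \<in> F) p \<and> {last p, hd p} \<in> F"
      then obtain p where p: "3 \<le> length p" "distinct p" "successively (\<lambda>x y. {x, y} \<in> F) p" "{last p, hd p} \<in> F"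
        by blast
      moreover have "successively (\<lambda>x y. {x, y} \<in> edges T') p"
        using p(3) by (rule successively_mono) (use F in auto)
      ultimately show False using target.tree F unfolding simplicial_tree_def by blast
    qed
  qed
  have F_act: "act T' g ` f \<in> F" if g: "g \<in> carrier G" and f: "f \<in> F" for g f
  proof -
    obtain x y a b xs ys where xy: "f = {x, y}" "{a, b} \<in> edges T" "\<gamma> a b = xs @ x # y # ys"
      using f unfolding F_def by blast
    have "\<gamma> (act T g a) (act T g b) = map (act T' g) (\<gamma> a b)"
      unfolding \<gamma>_def using source.edge_verts[OF xy(2)] g map_act map_verts target.act_geodesic by simp
    then have "{act T' g x, act T' g y} \<in> F"
      using FI[OF source.act_edge[OF g xy(2)]] xy(3) by simp
    then show ?thesis using xy(1) by simp
  qed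
  have W_act: "act T' g x \<in> W" if g: "g \<in> carrier G" and x: "x \<in> W" for g x
  proof (cases "x \<in> \<phi> ` verts T")
    case True
    then obtain a where "a \<in> verts T" "x = \<phi> a" by blast
    then have "act T' g x = \<phi> (act T g a)" "act T g a \<in> verts T"
      using g map_act source.act_closed by auto
    then show ?thesis unfolding W_def by blast
  next
    case False
    then obtain f where f: "f \<in> F" "x \<in> f" using x unfolding W_def by blast
    then have "act T' g x \<in> act T' g ` f" by blast
    then show ?thesis using F_act[OF g f(1)] unfolding W_def by blast
  qed
  have "minimal_gtree G T'" using target.gtree by (simp add: gtree_def)
  then have "F = edges T'"
    unfolding minimal_gtree_def
    by (rule allE[of _ W], elim allE[of _ F] mp[THEN conjunct2]) (simp add: W F tree_F W_act F_act)
  then have "e \<in> F" using e by simp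
  then obtain x y a b xs ys where "e = {x, y}" "{a, b} \<in> edges T" "\<gamma> a b = xs @ x # y # ys"
    unfolding F_def by blast
  then have "{a, b} \<in> edges T" "e \<subseteq> set (\<gamma> a b)" by auto
  then show ?thesis unfolding \<gamma>_def by blast
qed

text \<open>An element fixing \<open>a\<close> and \<open>b\<close> fixes their images, hence the
  whole geodesic between these, hence the edge \<open>e\<close> on it.\<close>

lemma edge_stabilizer_contains:
  assumes e: "e \<in> edges T'"
  shows "\<exists>e0\<in>edges T. edge_stabilizer G T e0 \<subseteq> edge_stabilizer G T' e"
proof -
  obtain a b where ab: "{a, b} \<in> edges T" and sub: "e \<subseteq> set (geodesic (edges T') (\<phi> a) (\<phi> b))"
    using edge_covered[OF e] by blast
  obtain x y where xy: "e = {x, y}" using e by (rule target.edgeE)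
  have "act T' g x = x \<and> act T' g y = y"
    if "g \<in> carrier G" "act T g a = a" "act T g b = b" for g
    using that sub xy source.edge_verts[OF ab] map_fixed map_verts target.geodesic_fixed
    by (metis insert_subset)
  then have "edge_stabilizer G T {a, b} \<subseteq> edge_stabilizer G T' e"
    using e xy target.edge_stabilizer_eq source.edge_stabilizer_eq[OF ab] by auto
  then show ?thesis using ab by blast
qed

end

text \<open>If \<open>G\<^sub>e\<close> fixes no edge of \<open>T'\<close>, it has a single fixed vertex \<open>v'\<close> there, which is also fixed by
  \<open>G\<^sub>v\<close> and \<open>G\<^sub>w\<close>. The stabilizer of \<open>v'\<close> fixes some \<open>u\<close> in \<open>T\<close>; since \<open>u\<close>, \<open>v\<close>, \<open>w\<close> lie on a
  geodesic, one of \<open>G\<^sub>v\<close>, \<open>G\<^sub>w\<close> equals \<open>G\<^sub>e\<close>. By reducedness \<open>w = g v\<close>, and then \<open>g\<close> fixes \<open>v'\<close>,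
  hence \<open>u\<close>, although \<open>u\<close> has different distances to \<open>v\<close> and \<open>w\<close>.\<close>

lemma reduced_edge_stabilizer_bi_elliptic:
  fixes G (structure)
  assumes "G_tree G T" "G_tree G T'" "same_deformation_space G T T'"
    and red: "reduced G T" and e: "e \<in> edges T"
  shows "bi_elliptic G T' (edge_stabilizer G T e)"
proof (rule ccontr)
  assume neg: "\<not> bi_elliptic G T' (edge_stabilizer G T e)"
  interpret source: G_tree G T by fact
  interpret target: G_tree G T' by fact
  obtain \<phi> where "vertex_map G T T' \<phi>" using vertex_map_exists[OF assms(1-3)] by blast
  then interpret forward: vertex_map G T T' \<phi> .
  have "same_deformation_space G T' T" using assms(3) by (simp add: same_deformation_space_def)
  then obtain \<psi> where "vertex_map G T' T \<psi>" using vertex_map_exists[OF assms(2,1)] by blast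
  then interpret backward: vertex_map G T' T \<psi> .
  obtain v w where vw: "e = {v, w}" "v \<in> verts T" "w \<in> verts T" "v \<noteq> w" using e by (rule source.edgeE)
  let ?H = "edge_stabilizer G T e"
  have H: "?H = {g \<in> carrier G. act T g v = v \<and> act T g w = w}"
    using source.edge_stabilizer_eq e vw by simp
  \<comment> \<open>Two distinct fixed vertices would be joined by a fixed geodesic, whose first
    edge would contradict \<open>neg\<close>.\<close>
  have unique: "x = y" if "x \<in> verts T'" "y \<in> verts T'" "\<forall>h\<in>?H. act T' h x = x" "\<forall>h\<in>?H. act T' h y = y" for x y
  proof (rule ccontr)
    assume "x \<noteq> y"
    note p = target.vertex_path_geodesic[OF that(1,2)]
    from p \<open>x \<noteq> y\<close> obtain q qs where g: "geodesic (edges T') x y = x # q # qs"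
      by (cases "geodesic (edges T') x y" rule: remdups_adj.cases) (auto simp: vertex_path_def)
    then have xq: "{x, q} \<in> edges T'" using p by (simp add: vertex_path_def)
    have "act T' h q = q" if "h \<in> ?H" for h
      using target.geodesic_fixed[of h x y q] that \<open>\<forall>h\<in>?H. act T' h x = x\<close> \<open>\<forall>h\<in>?H. act T' h y = y\<close> g
        \<open>x \<in> verts T'\<close> \<open>y \<in> verts T'\<close> H by auto
    then have "?H \<subseteq> edge_stabilizer G T' {x, q}"
      using target.edge_stabilizer_eq[OF xq] H \<open>\<forall>h\<in>?H. act T' h x = x\<close> by auto
    then show False using neg xq source.edge_stabilizer_subgroup[OF e] by (auto simp: bi_elliptic_def)
  qed
  have fix_v: "\<forall>h\<in>?H. act T' h (\<phi> v) = \<phi> v" and fix_w: "\<forall>h\<in>?H. act T' h (\<phi> w) = \<phi> w"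
    using H forward.map_fixed vw by auto
  have eq: "\<phi> v = \<phi> w" using unique forward.map_verts fix_v fix_w vw by simp
  \<comment> \<open>By equivariance of \<open>\<psi>\<close>, everything that fixes
    \<open>\<phi> v\<close> fixes \<open>u\<close>.\<close>
  define u where "u = \<psi> (\<phi> v)"
  have u: "u \<in> verts T" unfolding u_def using forward.map_verts backward.map_verts vw by simp
  \<comment> \<open>Here \<open>y\<close> is the end of \<open>e\<close> farther from
    \<open>u\<close>. Its stabilizer fixes \<open>\<phi> v\<close>, hence \<open>u\<close>, hence
    the vertex \<open>z\<close> on the way to \<open>u\<close>.\<close>
  have False if yz: "{y, z} = {v, w}" "z \<in> set (geodesic (edges T) y u)" for y z
  proof -
    have yzV: "y \<in> verts T" "z \<in> verts T" "{y, z} \<in> edges T" using yz vw e by auto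
    have \<phi>y: "\<phi> y = \<phi> v" "\<phi> z = \<phi> v" using yz eq by (metis doubleton_eq_iff)+
    have fix_u: "act T g u = u" if "g \<in> carrier G" "act T' g (\<phi> v) = \<phi> v" for g
      unfolding u_def using backward.map_fixed that forward.map_verts vw by simp
    have "act T g z = z" if g: "g \<in> carrier G" "act T g y = y" for g
      using source.geodesic_fixed[OF g(1) yzV(1) u g(2) fix_u yz(2)] g forward.map_fixed yzV(1) \<phi>y by metis
    then have Hy: "edge_stabilizer G T {y, z} = vertex_stabilizer G T y"
      using source.edge_stabilizer_eq[OF yzV(3)] by (auto simp: stabilizer_def)
    then have "z \<in> orbit G (act T) y" using red yzV(3) unfolding reduced_def by blast
    then obtain g where g: "g \<in> carrier G" "act T g y = z" unfolding orbit_def by blast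
    have "act T' g (\<phi> v) = \<phi> v" using forward.map_act[OF g(1) yzV(1)] g \<phi>y by simp
    then have "geodesic (edges T) z u = map (act T g) (geodesic (edges T) y u)"
      using source.act_geodesic[OF g(1) yzV(1) u] fix_u g by simp
    then show False using source.geodesic_neighbour_cases(2)[OF yzV(3) u] by simp
  qed
  then show False
    using source.geodesic_neighbour_cases(1)[of v w u] u e vw by (metis insert_commute)
qed

section \<open>Points and morphisms\<close>

definition edge_point :: "'v \<Rightarrow> 'v \<Rightarrow> real \<Rightarrow> 'v \<Rightarrow> real" where
  "edge_point a b s = (\<lambda>v. (1 - s) * vertex_point a v + s * vertex_point b v)"

lemma edge_point_0 [simp]: "edge_point a b 0 = vertex_point a"
  and edge_point_1 [simp]: "edge_point a b 1 = vertex_point b"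
  by (simp_all add: edge_point_def)

lemma edge_point_source: "a \<noteq> b \<Longrightarrow> edge_point a b s a = 1 - s"
  by (simp add: edge_point_def vertex_point_def)

lemma edge_point_target: "a \<noteq> b \<Longrightarrow> edge_point a b s b = s"
  by (simp add: edge_point_def vertex_point_def)

lemma edge_point_inject: "a \<noteq> b \<Longrightarrow> edge_point a b s = edge_point a b t \<longleftrightarrow> s = t"
  by (metis edge_point_target)

text \<open>Continuity for pointwise convergence is checked coordinatewise, and the coordinate at
  \<open>b\<close> recovers the parameter.\<close>

lemma arc_edge_point:
  assumes "a \<noteq> b" "continuous_on {0..1} h" "inj_on h {0..1}"
  shows "arc (\<lambda>t. edge_point a b (h t))"
proof -
  have "continuous_on {0..1} (\<lambda>t. edge_point a b (h t))"
    unfolding edge_point_def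
    by (intro continuous_on_coordinatewise_then_product continuous_intros assms)
  moreover have "inj_on (\<lambda>t. edge_point a b (h t)) {0..1}"
    using assms by (simp add: inj_on_def edge_point_inject)
  ultimately show ?thesis by (simp add: arc_def path_def)
qed

text \<open>The walk \<open>p\<close> traversed at constant speed in unit time: at time \<open>t\<close> the coordinate at the
  \<open>i\<close>-th vertex of \<open>p\<close> is a hat function centred at \<open>i / (length p - 1)\<close>.\<close>

definition polyline :: "'v list \<Rightarrow> real \<Rightarrow> 'v \<Rightarrow> real" where
  "polyline p t =
     (\<lambda>v. \<Sum>i<length p. max 0 (1 - \<bar>real (length p - 1) * t - real i\<bar>) * vertex_point (p ! i) v)"

text \<open>Writing the walk as one finite sum of hats avoids gluing at the subdivision times. Walks
  may revisit vertices, since the contributions simply add up.\<close>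

lemma continuous_polyline: "continuous_on A h \<Longrightarrow> continuous_on A (\<lambda>x. polyline p (h x))"
  unfolding polyline_def
  by (intro continuous_on_coordinatewise_then_product continuous_intros)

text \<open>On the \<open>i\<close>-th of the \<open>length p - 1\<close> time intervals only two
  hats survive, with heights \<open>1 - s\<close> and \<open>s\<close>.\<close>

lemma polyline_edge_point:
  assumes i: "Suc i < length p" and s: "0 \<le> s" "s \<le> 1"
  shows "polyline p ((real i + s) / real (length p - 1)) = edge_point (p ! i) (p ! Suc i) s"
proof
  fix v
  let ?w = "\<lambda>j. max 0 (1 - \<bar>real i + s - real j\<bar>) * vertex_point (p ! j) v"
  have "polyline p ((real i + s) / real (length p - 1)) v = (\<Sum>j<length p. ?w j)"
    using i by (simp add: polyline_def)
  also have "\<dots> = (\<Sum>j\<in>{i, Suc i}. ?w j)"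
  proof (rule sum.mono_neutral_right)
    show "\<forall>j\<in>{..<length p} - {i, Suc i}. ?w j = 0"
    proof
      fix j assume "j \<in> {..<length p} - {i, Suc i}"
      then consider "j + 1 \<le> i" | "i + 2 \<le> j" by force
      then have "1 \<le> \<bar>real i + s - real j\<bar>" using s by cases linarith+
      then show "?w j = 0" by simp
    qed
  qed (use i in auto)
  also have "\<dots> = edge_point (p ! i) (p ! Suc i) s v"
    using s by (simp add: edge_point_def)
  finally show "polyline p ((real i + s) / real (length p - 1)) v = edge_point (p ! i) (p ! Suc i) s v" .
qed

lemma polyline_0:
  assumes "2 \<le> length p"
  shows "polyline p 0 = vertex_point (hd p)"
  using polyline_edge_point[of 0 p 0] assms by (cases p) (auto simp: Suc_le_eq)

lemma polyline_1:
  assumes "2 \<le> length p"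
  shows "polyline p 1 = vertex_point (last p)"
proof -
  have "Suc (length p - 2) < length p" "Suc (length p - 2) = length p - 1"
    "(real (length p - 2) + 1) / real (length p - 1) = 1"
    using assms by auto
  then show ?thesis
    using polyline_edge_point[of "length p - 2" p 1] assms
    by (subst last_conv_nth) auto
qed

lemma unit_interval_subdivision:
  fixes t :: real
  assumes "0 < n" "0 \<le> t" "t \<le> 1"
  obtains i s where "i < n" "0 \<le> s" "s \<le> 1" "t = (real i + s) / real n"
proof (cases "t = 1")
  \<comment> \<open>The floor of \<open>n * t\<close> would be \<open>n\<close> here, one too many;
    the point is taken as the right end of the last interval.\<close>
  case True
  then show thesis using assms by (intro that[of "n - 1" 1]) auto
next
  case False
  define i where "i = nat \<lfloor>real n * t\<rfloor>"
  have le: "real i \<le> real n * t" "real n * t \<le> real i + 1" unfolding i_def using assms by auto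
  moreover have "real n * t < real n" using False assms by auto
  ultimately have "i < n" by linarith
  then show thesis using assms le by (intro that[of i "real n * t - real i"]) (auto simp: field_simps)
qed

section \<open>Closed edges, the action on points, and arcs\<close>

context G_tree
begin

lemma edge_point_closed_edge:
  assumes e: "{a, b} \<in> edges T" and s: "0 \<le> s" "s \<le> 1"
  shows "edge_point a b s \<in> closed_edge T {a, b}"
proof -
  have ab: "a \<in> verts T" "b \<in> verts T" "a \<noteq> b" using edge_verts[OF e] by auto
  have sub: "{v. edge_point a b s v \<noteq> 0} \<subseteq> {a, b}"
    by (auto simp: edge_point_def vertex_point_def indicator_def)
  have "edge_point a b s \<in> realization T"
  proof -
    \<comment> \<open>At the two extreme parameters the support shrinks to a single vertex.\<close>
    consider "s = 0" | "s = 1" | "0 < s" "s < 1" using s by linarith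
    then show ?thesis
    proof cases
      case 3
      then have "{v. edge_point a b s v \<noteq> 0} = {a, b}"
        using sub ab by (auto simp: edge_point_def vertex_point_def)
      then show ?thesis
        using e ab s by (auto simp: realization_def edge_point_def vertex_point_def)
    qed (use ab vertex_point_realization in auto)
  qed
  then show ?thesis using sub by (simp add: closed_edge_def)
qed

lemma closed_edge_coordinates:
  assumes e: "{a, b} \<in> edges T" and x: "x \<in> closed_edge T {a, b}"
  shows "0 \<le> x b" "x b \<le> 1" "x = edge_point a b (x b)"
proof -
  have ab: "a \<noteq> b" using edge_verts[OF e] by auto
  have pos: "0 \<le> x v" for v using x by (simp add: closed_edge_def realization_def)
  have sub: "{v. x v \<noteq> 0} \<subseteq> {a, b}" and "(\<Sum>v\<in>{v. x v \<noteq> 0}. x v) = 1"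
    using x by (simp_all add: closed_edge_def realization_def)
  moreover have "(\<Sum>v\<in>{v. x v \<noteq> 0}. x v) = (\<Sum>v\<in>{a, b}. x v)"
    using sub by (intro sum.mono_neutral_left) auto
  ultimately have sum: "x a + x b = 1" using ab by simp
  then show "0 \<le> x b" "x b \<le> 1" using pos[of a] pos[of b] by auto
  have xv: "x v = 0" if "v \<noteq> a" "v \<noteq> b" for v using sub that by blast
  have "x v = edge_point a b (x b) v" for v
    using sum ab xv by (cases "v = a"; cases "v = b") (auto simp: edge_point_def vertex_point_def)
  then show "x = edge_point a b (x b)" by blast
qed

lemma closed_edge_eq:
  assumes "{a, b} \<in> edges T"
  shows "closed_edge T {a, b} = edge_point a b ` {0..1}"
  using closed_edge_coordinates[OF assms] edge_point_closed_edge[OF assms] by fastforce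

lemma point_act_act:
  assumes "g \<in> carrier G" "v \<in> verts T"
  shows "point_act G T g x (act T g v) = x v"
  using assms by (simp add: point_act_def act_closed act_inv_act)

lemma point_act_support:
  assumes g: "g \<in> carrier G" and x: "x \<in> realization T"
  shows "{v. point_act G T g x v \<noteq> 0} = act T g ` {v. x v \<noteq> 0}"
proof
  show "{v. point_act G T g x v \<noteq> 0} \<subseteq> act T g ` {v. x v \<noteq> 0}"
  proof
    fix v assume "v \<in> {v. point_act G T g x v \<noteq> 0}"
    then have "v \<in> verts T" "x (act T (inv g) v) \<noteq> 0" by (auto simp: point_act_def split: if_splits)
    then show "v \<in> act T g ` {v. x v \<noteq> 0}"
      using g act_act_inv by (metis (mono_tags, lifting) image_eqI mem_Collect_eq)
  qed
  show "act T g ` {v. x v \<noteq> 0} \<subseteq> {v. point_act G T g x v \<noteq> 0}"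
    using support_subset[OF x] g by (auto simp: point_act_act)
qed

lemma point_act_fixed:
  assumes g: "g \<in> carrier G" and x: "x \<in> realization T"
    and fixed: "\<And>v. x v \<noteq> 0 \<Longrightarrow> act T g v = v"
  shows "point_act G T g x = x"
proof
  fix v
  show "point_act G T g x v = x v"
  proof (cases "v \<in> verts T")
    case True
    let ?w = "act T (inv g) v"
    have w: "?w \<in> verts T" "act T g ?w = v" using True g act_closed act_act_inv by auto
    show ?thesis
    \<comment> \<open>If either \<open>v\<close> or \<open>?w\<close> lies in the support, it is
      fixed by \<open>g\<close>, which forces \<open>?w = v\<close>; otherwise both coordinates are
      0.\<close>
    proof (cases "x v = 0 \<and> x ?w = 0")
      case False
      then have "?w = v" using fixed act_eq_iff[OF g] w True by metis
      then show ?thesis using True by (simp add: point_act_def)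
    qed (use True in \<open>simp add: point_act_def\<close>)
  next
    case False
    then show ?thesis using support_subset[OF x] by (auto simp: point_act_def)
  qed
qed

lemma point_act_polyline:
  assumes g: "g \<in> carrier G" and p: "set p \<subseteq> verts T"
  shows "point_act G T g (polyline p t) = polyline (map (act T g) p) t"
proof
  fix v
  have vp: "point_act G T g (vertex_point (p ! i)) = vertex_point (act T g (p ! i))" if "i < length p" for i
    using p that by (intro point_act_vertex_point[OF g]) auto
  have *: "(if v \<in> verts T then vertex_point (p ! i) (act T (inv g) v) else 0) =
      vertex_point (act T g (p ! i)) v" if "i < length p" for i
    using fun_cong[OF vp[OF that], of v] unfolding point_act_def by (simp only:)
  have "point_act G T g (polyline p t) v =
      (\<Sum>i<length p. max 0 (1 - \<bar>real (length p - 1) * t - real i\<bar>) *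
        (if v \<in> verts T then vertex_point (p ! i) (act T (inv g) v) else 0))"
    by (simp add: point_act_def polyline_def)
  also have "\<dots> = polyline (map (act T g) p) t v"
    unfolding polyline_def using * by (intro sum.cong) auto
  finally show "point_act G T g (polyline p t) v = polyline (map (act T g) p) t v" .
qed

lemma polyline_realization:
  assumes p: "successively (\<lambda>x y. {x, y} \<in> edges T) p" "2 \<le> length p" and t: "0 \<le> t" "t \<le> 1"
  shows "polyline p t \<in> realization T"
proof -
  have "0 < length p - 1" using p(2) by simp
  then obtain i s where i: "i < length p - 1" and s: "0 \<le> s" "s \<le> 1"
    and "t = (real i + s) / real (length p - 1)"
    using unit_interval_subdivision[OF _ t] by blast
  then have "polyline p t = edge_point (p ! i) (p ! Suc i) s"
    using polyline_edge_point[of i p s] by simp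
  moreover have "{p ! i, p ! Suc i} \<in> edges T"
    using p(1) i by (auto simp: successively_conv_nth)
  ultimately show ?thesis using edge_point_closed_edge s by (simp add: closed_edge_def)
qed

text \<open>On an arc of vertex points every coordinate would take only the values 0 and 1. By
  connectedness it would be constant, although the ends of an arc differ in some coordinate.\<close>

lemma arc_meets_open_edge:
  assumes arc: "arc \<gamma>" and sub: "path_image \<gamma> \<subseteq> realization T"
  shows "\<exists>x\<in>path_image \<gamma>. {v. x v \<noteq> 0} \<in> edges T"
proof (rule ccontr)
  assume neg: "\<not> (\<exists>x\<in>path_image \<gamma>. {v. x v \<noteq> 0} \<in> edges T)"
  have *: "x v \<in> {0, 1}" if x: "x \<in> path_image \<gamma>" for x v
  proof -
    have "x \<in> realization T" using sub x by blast
    moreover obtain w where "{v. x v \<noteq> 0} = {w}"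
      using \<open>x \<in> realization T\<close> by (rule support_cases) (use neg x in auto)
    ultimately show ?thesis by (cases "v = w") (auto simp: realization_def)
  qed
  have "\<gamma> 0 \<noteq> \<gamma> 1" using arc_distinct_ends[OF arc] by (simp add: pathstart_def pathfinish_def)
  then obtain v where v: "\<gamma> 0 v \<noteq> \<gamma> 1 v" by blast
  have "continuous_on {0..1} (\<lambda>t. \<gamma> t v)"
    using arc by (auto simp: arc_def path_def intro: continuous_on_product_then_coordinatewise)
  then have conn: "connected ((\<lambda>t. \<gamma> t v) ` {0..1})" by (rule connected_continuous_image) simp
  have sub01: "(\<lambda>t. \<gamma> t v) ` {0..1} \<subseteq> {0, 1}" using * by (auto simp: path_image_def)
  have ends: "\<gamma> 0 v \<in> (\<lambda>t. \<gamma> t v) ` {0..1}" "\<gamma> 1 v \<in> (\<lambda>t. \<gamma> t v) ` {0..1}" by auto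
  then have "0 \<in> (\<lambda>t. \<gamma> t v) ` {0..1}" "1 \<in> (\<lambda>t. \<gamma> t v) ` {0..1}"
    using v subsetD[OF sub01 ends(1)] subsetD[OF sub01 ends(2)] by auto
  then have "1 / 2 \<in> (\<lambda>t. \<gamma> t v) ` {0..1}" by (rule connectedD_interval[OF conn]) auto
  then have "1 / 2 \<in> {0, 1 :: real}" using sub01 by blast
  then show False by simp
qed

end

section \<open>From morphisms to containments of edge stabilizers\<close>

lemma morphism_edge_stabilizer:
  fixes G (structure)
  assumes "G_tree G T" "G_tree G T'" and f: "tree_morphism G T T' f" and e: "e \<in> edges T"
  shows "\<exists>e'\<in>edges T'. edge_stabilizer G T e \<subseteq> edge_stabilizer G T' e'"
proof -
  interpret source: G_tree G T by fact
  interpret target: G_tree G T' by fact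
  obtain a b where ab: "e = {a, b}" using e by (rule source.edgeE)
  have nonempty: "closed_edge T e \<noteq> {}" using source.edge_point_closed_edge[of a b 0] e ab by auto
  have f_range: "f \<in> realization T \<rightarrow> realization T'"
    and f_act: "\<forall>g\<in>carrier G. \<forall>x\<in>realization T. f (point_act G T g x) = point_act G T' g (f x)"
    and segments: "\<forall>e\<in>edges T. \<exists>\<S>. finite \<S> \<and> \<Union>\<S> = closed_edge T e \<and>
        (\<forall>S\<in>\<S>. segment_in (closed_edge T e) S \<and>
                inj_on f S \<and> segment_in (realization T') (f ` S))"
    using f by (simp_all add: tree_morphism_def)
  obtain \<S> where "\<Union>\<S> = closed_edge T e"
    "\<forall>S\<in>\<S>. segment_in (closed_edge T e) S \<and> inj_on f S \<and> segment_in (realization T') (f ` S)"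
    using bspec[OF segments e] by auto
  \<comment> \<open>A nonempty closed edge has at least one piece in its decomposition; the image of
    that piece is an arc, so it cannot consist of vertices alone.\<close>
  then obtain S where S: "S \<subseteq> closed_edge T e" "segment_in (realization T') (f ` S)"
    using nonempty by blast
  then obtain \<gamma> where \<gamma>: "arc \<gamma>" "path_image \<gamma> = f ` S" "f ` S \<subseteq> realization T'"
    unfolding segment_in_def by blast
  then obtain x where x: "x \<in> S" and fx: "{v. f x v \<noteq> 0} \<in> edges T'"
    using target.arc_meets_open_edge[of \<gamma>] by auto
  have xe: "x \<in> realization T" "{v. x v \<noteq> 0} \<subseteq> e" using x S(1) by (auto simp: closed_edge_def)
  have "g \<in> edge_stabilizer G T' {v. f x v \<noteq> 0}" if "g \<in> edge_stabilizer G T e" for g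
  proof -
    have g: "g \<in> carrier G" "act T g a = a" "act T g b = b"
      using that source.edge_stabilizer_eq e ab by auto
    then have "point_act G T g x = x"
      using source.point_act_fixed[OF g(1) xe(1)] xe(2) ab by blast
    then have "point_act G T' g (f x) = f x"
      using f_act g(1) xe(1) by metis
    moreover have "f x \<in> realization T'" using f_range xe(1) by blast
    ultimately have "act T' g v = v" if "f x v \<noteq> 0" for v
      using target.fixed_support g(1) that by blast
    then have "act T' g ` {v. f x v \<noteq> 0} = {v. f x v \<noteq> 0}" by force
    then show ?thesis using g(1) by (simp add: stabilizer_def)
  qed
  then show ?thesis using fx by blast
qed

section \<open>Morphisms from equivariant families of walks\<close>

context vertex_map
begin

text \<open>The triple records an orientation of the edge together with the walk, so that the
  coordinate at \<open>b\<close> can serve as time. The bound on the length prevents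
  collapsing.\<close>

definition edge_walk :: "'v set \<Rightarrow> 'v \<times> 'v \<times> 'w list \<Rightarrow> bool" where
  "edge_walk e = (\<lambda>(a, b, p). e = {a, b} \<and> 2 \<le> length p \<and>
     successively (\<lambda>x y. {x, y} \<in> edges T') p \<and> hd p = \<phi> a \<and> last p = \<phi> b)"

definition walk_act :: "'a \<Rightarrow> 'v \<times> 'v \<times> 'w list \<Rightarrow> 'v \<times> 'v \<times> 'w list" where
  "walk_act g = (\<lambda>(a, b, p). (act T g a, act T g b, map (act T' g) p))"

text \<open>An edge whose ends have the same image cannot be collapsed; it is sent back and forth along an
  edge fixed by its stabilizer.\<close>

lemma fixed_edge_walk:
  assumes e: "{a, b} \<in> edges T" and e': "e' \<in> edges T'"
    and sub: "edge_stabilizer G T {a, b} \<subseteq> edge_stabilizer G T' e'"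
  shows "\<exists>p. edge_walk {a, b} (a, b, p) \<and>
    (\<forall>g\<in>edge_stabilizer G T {a, b}. \<forall>x\<in>set p. act T' g x = x)"
proof -
  let ?H = "edge_stabilizer G T {a, b}"
  have ab: "a \<in> verts T" "b \<in> verts T" using source.edge_verts[OF e] by auto
  have \<phi>: "\<phi> a \<in> verts T'" "\<phi> b \<in> verts T'" using ab map_verts by auto
  have H: "g \<in> carrier G" "act T' g (\<phi> a) = \<phi> a" "act T' g (\<phi> b) = \<phi> b" if "g \<in> ?H" for g
    using that source.edge_stabilizer_eq[OF e] map_fixed ab by auto
  have geod: "\<exists>q qs. geodesic (edges T') x y = x # q # qs \<and> vertex_path (edges T') x (x # q # qs) y"
    if "x \<in> verts T'" "y \<in> verts T'" "x \<noteq> y" for x y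
    using target.vertex_path_geodesic[OF that(1,2)] that(3)
    by (cases "geodesic (edges T') x y" rule: remdups_adj.cases) (auto simp: vertex_path_def)
  show ?thesis
  proof (cases "\<phi> a = \<phi> b")
    case False
    then obtain q qs where p: "geodesic (edges T') (\<phi> a) (\<phi> b) = \<phi> a # q # qs"
      "vertex_path (edges T') (\<phi> a) (\<phi> a # q # qs) (\<phi> b)" using geod \<phi> by blast
    then have "edge_walk {a, b} (a, b, \<phi> a # q # qs)" by (simp add: edge_walk_def vertex_path_def)
    moreover have "\<forall>g\<in>?H. \<forall>x\<in>set (\<phi> a # q # qs). act T' g x = x"
      using H target.geodesic_fixed[OF _ \<phi>] p(1) by metis
    ultimately show ?thesis by blast
  next
    case True
    obtain c d where cd: "e' = {c, d}" "c \<in> verts T'" "d \<in> verts T'" "c \<noteq> d" using e' by (rule target.edgeE)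
    have Hcd: "act T' g c = c" "act T' g d = d" if "g \<in> ?H" for g
      using subsetD[OF sub that] target.edge_stabilizer_eq e' cd by auto
    \<comment> \<open>The edge \<open>e'\<close> may be far from \<open>\<phi> a\<close>. If
      \<open>\<phi> a = c\<close>, the other end \<open>d\<close> serves as \<open>q\<close>;
      otherwise the first step of the geodesic to \<open>c\<close> does, since both ends of that
      geodesic are fixed.\<close>
    have "\<exists>q. {\<phi> a, q} \<in> edges T' \<and> (\<forall>g\<in>?H. act T' g q = q)"
    proof (cases "\<phi> a = c")
      case True
      then show ?thesis using e' cd Hcd by auto
    next
      case False
      then obtain q qs where p: "geodesic (edges T') (\<phi> a) c = \<phi> a # q # qs"
        "vertex_path (edges T') (\<phi> a) (\<phi> a # q # qs) c" using geod \<phi> cd by blast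
      then have "{\<phi> a, q} \<in> edges T'" by (simp add: vertex_path_def)
      moreover have "act T' g q = q" if "g \<in> ?H" for g
        using target.geodesic_fixed[OF _ \<phi>(1) cd(2), of g q] H[OF that] Hcd[OF that] p(1) by simp
      ultimately show ?thesis by blast
    qed
    then obtain q where "{\<phi> a, q} \<in> edges T'" "\<forall>g\<in>?H. act T' g q = q" by blast
    then have "edge_walk {a, b} (a, b, [\<phi> a, q, \<phi> a]) \<and>
        (\<forall>g\<in>?H. \<forall>x\<in>set [\<phi> a, q, \<phi> a]. act T' g x = x)"
      using True H by (auto simp: edge_walk_def insert_commute)
    then show ?thesis by blast
  qed
qed

lemma edge_walk_verts: "edge_walk e (a, b, p) \<Longrightarrow> e \<in> edges T \<Longrightarrow> set p \<subseteq> verts T'"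
  using target.walk_subset map_verts source.edge_verts by (auto simp: edge_walk_def)

lemma equivariant_edge_walks:
  assumes dom: "\<forall>e\<in>edges T. \<exists>e'\<in>edges T'. edge_stabilizer G T e \<subseteq> edge_stabilizer G T' e'"
  shows "\<exists>\<sigma>. \<forall>e\<in>edges T. edge_walk e (\<sigma> e) \<and>
    (\<forall>g\<in>carrier G. \<sigma> (act T g ` e) = walk_act g (\<sigma> e))"
proof (rule source.equivariant_choice)
  fix e assume e: "e \<in> edges T"
  show "g \<in> carrier G \<Longrightarrow> act T g ` e \<in> edges T" for g
    using e source.gtree unfolding gtree_def by blast
  have V: "e \<subseteq> verts T" using e by (rule source.edgeE) auto
  then show "act T \<one> ` e = e" using source.act_one by force
  show "act T (g \<otimes> h) ` e = act T g ` act T h ` e" if "g \<in> carrier G" "h \<in> carrier G" for g h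
    using V source.act_mult[OF that] by (force simp: image_image)
  \<comment> \<open>This relies on all vertices of an admissible walk lying in
    \<open>verts T'\<close>, where \<open>act T'\<close> is an action.\<close>
  show "walk_act (g \<otimes> h) y = walk_act g (walk_act h y)"
    if "g \<in> carrier G" "h \<in> carrier G" "edge_walk e y" for g h y
  proof -
    obtain a b p where y: "y = (a, b, p)" by (cases y)
    then have "set p \<subseteq> verts T'" "a \<in> verts T" "b \<in> verts T"
      using edge_walk_verts that(3) e V by (auto simp: edge_walk_def)
    then show ?thesis
      using source.act_mult[OF that(1,2)] target.act_mult[OF that(1,2)] y by (auto simp: walk_act_def)
  qed
  show "edge_walk (act T g ` e) (walk_act g y)" if g: "g \<in> carrier G" and "edge_walk e y" for g y
  proof -
    obtain a b p where y: "y = (a, b, p)" by (cases y)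
    have p: "e = {a, b}" "2 \<le> length p" "successively (\<lambda>x y. {x, y} \<in> edges T') p"
      "hd p = \<phi> a" "last p = \<phi> b" using that y by (auto simp: edge_walk_def)
    have "successively (\<lambda>x y. {act T' g x, act T' g y} \<in> edges T') p"
      using p(3) by (rule successively_mono) (use target.act_edge[OF g] in auto)
    moreover have "p \<noteq> []" using p by auto
    ultimately show ?thesis
      using p y V map_act[OF g] by (auto simp: edge_walk_def walk_act_def successively_map hd_map last_map)
  qed
  obtain a b where ab: "e = {a, b}" using e by (rule source.edgeE)
  obtain p where p: "edge_walk e (a, b, p)" "\<forall>g\<in>edge_stabilizer G T e. \<forall>x\<in>set p. act T' g x = x"
    using fixed_edge_walk dom e unfolding ab by blast
  \<comment> \<open>Without inversions the stabilizer of \<open>e\<close> fixes both ends, so it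
    preserves the orientation as well as the walk.\<close>
  have "walk_act g (a, b, p) = (a, b, p)" if "g \<in> carrier G" "act T g ` e = e" for g
  proof -
    have "g \<in> edge_stabilizer G T e" using that by (simp add: stabilizer_def)
    then show ?thesis
      using p(2) source.edge_stabilizer_eq e unfolding ab by (auto simp: walk_act_def intro: map_idI)
  qed
  then show "\<exists>y. edge_walk e y \<and> (\<forall>g\<in>carrier G. act T g ` e = e \<longrightarrow> walk_act g y = y)"
    using p(1) by blast
qed

definition walk_map :: "('v set \<Rightarrow> 'v \<times> 'v \<times> 'w list) \<Rightarrow> ('v \<Rightarrow> real) \<Rightarrow> 'w \<Rightarrow> real" where
  "walk_map \<sigma> x =
     (let S = {v. x v \<noteq> 0} in
      if S \<in> edges T then case \<sigma> S of (a, b, p) \<Rightarrow> polyline p (x b)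
      else vertex_point (\<phi> (the_elem S)))"

lemma walk_map_vertex:
  assumes "{v. x v \<noteq> 0} = {v}"
  shows "walk_map \<sigma> x = vertex_point (\<phi> v)"
proof -
  have "{v} \<notin> edges T" by (metis source.edge_verts insert_absorb2)
  then show ?thesis using assms by (simp add: walk_map_def)
qed

text \<open>The two branches of \<open>walk_map\<close> agree at the ends of the edge, because the
  walk starts at \<open>\<phi> a\<close> and stops at \<open>\<phi> b\<close>. One formula thus
  governs the whole closed edge.\<close>

lemma walk_map_closed_edge:
  assumes e: "e \<in> edges T" and \<sigma>: "edge_walk e (a, b, p)" "\<sigma> e = (a, b, p)"
    and x: "x \<in> closed_edge T e"
  shows "walk_map \<sigma> x = polyline p (x b)"
proof -
  have ab: "e = {a, b}" "a \<noteq> b" and p: "2 \<le> length p" "hd p = \<phi> a" "last p = \<phi> b"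
    using \<sigma>(1) source.edge_verts e by (auto simp: edge_walk_def)
  have x_eq: "x = edge_point a b (x b)" using source.closed_edge_coordinates(3) e x ab by blast
  then have xa: "x a = 1 - x b"
    using trans[OF fun_cong[OF x_eq, of a] edge_point_source[OF ab(2)]] by simp
  have "{v. x v \<noteq> 0} \<subseteq> {a, b}" using x ab by (simp add: closed_edge_def)
  then consider "{v. x v \<noteq> 0} = e" | "{v. x v \<noteq> 0} = {a}" "x b = 0" | "{v. x v \<noteq> 0} = {b}" "x b = 1"
  proof -
    have "{v. x v \<noteq> 0} = {v \<in> {a, b}. x v \<noteq> 0}" using \<open>{v. x v \<noteq> 0} \<subseteq> {a, b}\<close> by auto
    moreover have "{v \<in> {a, b}. x v \<noteq> 0} = (if x a = 0 then {} else {a}) \<union> (if x b = 0 then {} else {b})"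
      by auto
    ultimately show thesis
      using that xa ab by (cases "x a = 0"; cases "x b = 0") (simp_all add: insert_commute)
  qed
  then show ?thesis
  proof cases
    case 1
    then show ?thesis using e \<sigma>(2) by (simp add: walk_map_def)
  qed (simp_all add: p walk_map_vertex polyline_0[OF p(1)] polyline_1[OF p(1)])
qed

text \<open>Cutting an edge into as many equal parts as its walk has edges makes the map simplicial:
  the \<open>i\<close>-th part goes affinely onto the \<open>i\<close>-th edge of the walk.
  Backtracking of the walk can only affect injectivity across different parts.\<close>

lemma walk_map_morphism:
  assumes \<sigma>: "\<forall>e\<in>edges T. edge_walk e (\<sigma> e) \<and>
    (\<forall>g\<in>carrier G. \<sigma> (act T g ` e) = walk_act g (\<sigma> e))"
  shows "tree_morphism G T T' (walk_map \<sigma>)"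
proof -
  let ?f = "walk_map \<sigma>"
  have edge: "\<exists>a b p. \<sigma> e = (a, b, p) \<and> edge_walk e (a, b, p) \<and> e = {a, b} \<and> {a, b} \<in> edges T \<and>
      a \<noteq> b \<and> a \<in> verts T \<and> b \<in> verts T \<and> 2 \<le> length p \<and>
      successively (\<lambda>x y. {x, y} \<in> edges T') p \<and> set p \<subseteq> verts T' \<and>
      (\<forall>x\<in>closed_edge T e. ?f x = polyline p (x b) \<and> 0 \<le> x b \<and> x b \<le> 1)"
    if e: "e \<in> edges T" for e
  proof -
    obtain a b p where s: "\<sigma> e = (a, b, p)" by (cases "\<sigma> e")
    then have w: "edge_walk e (a, b, p)" using \<sigma> e by metis
    then have ab: "e = {a, b}" by (simp add: edge_walk_def)
    show ?thesis
      using s w ab e source.edge_verts[of a b] edge_walk_verts[OF w e] walk_map_closed_edge[where \<sigma> = \<sigma>, OF e w s]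
        source.closed_edge_coordinates(1,2)[of a b]
      by (auto simp: edge_walk_def)
  qed
  have f_range: "?f \<in> realization T \<rightarrow> realization T'"
  proof
    fix x assume x: "x \<in> realization T"
    then show "?f x \<in> realization T'"
    proof (rule source.support_cases)
      fix v assume "v \<in> verts T" "{w. x w \<noteq> 0} = {v}"
      then show ?thesis using walk_map_vertex vertex_point_realization map_verts by metis
    next
      fix u v assume e: "{u, v} \<in> edges T" and S: "{w. x w \<noteq> 0} = {u, v}"
      then have "x \<in> closed_edge T {u, v}" using x by (simp add: closed_edge_def)
      then show ?thesis using edge[OF e] target.polyline_realization by metis
    qed
  qed
  have f_act: "?f (point_act G T g x) = point_act G T' g (?f x)"
    if g: "g \<in> carrier G" and x: "x \<in> realization T" for g x
    using x
  proof (rule source.support_cases)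
    fix v assume v: "v \<in> verts T" and S: "{w. x w \<noteq> 0} = {v}"
    have "{w. point_act G T g x w \<noteq> 0} = {act T g v}"
      using source.point_act_support[OF g x] S by simp
    then show ?thesis
      using walk_map_vertex[OF S] walk_map_vertex target.point_act_vertex_point[OF g] map_verts map_act g v
      by metis
  next
    fix u v assume "{u, v} \<in> edges T" and S: "{w. x w \<noteq> 0} = {u, v}"
    then obtain a b p where s: "\<sigma> {u, v} = (a, b, p)" and b: "b \<in> verts T" and p: "set p \<subseteq> verts T'"
      using edge by metis
    have S': "{w. point_act G T g x w \<noteq> 0} = act T g ` {u, v}"
      using source.point_act_support[OF g x] S by simp
    have e': "act T g ` {u, v} \<in> edges T" using source.act_edge[OF g \<open>{u, v} \<in> edges T\<close>] by simp
    have "\<sigma> (act T g ` {u, v}) = walk_act g (a, b, p)"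
      using \<sigma> g \<open>{u, v} \<in> edges T\<close> s by metis
    then have s': "\<sigma> (act T g ` {u, v}) = (act T g a, act T g b, map (act T' g) p)"
      by (simp add: walk_act_def)
    \<comment> \<open>Translating the point also translates the oriented edge: the coordinate of
      \<open>g x\<close> at \<open>g b\<close> is that of \<open>x\<close> at \<open>b\<close>, so
      the time along the walk is unchanged.\<close>
    have "?f (point_act G T g x) = polyline (map (act T' g) p) (point_act G T g x (act T g b))"
      unfolding walk_map_def Let_def S' s' using e' by simp
    moreover have "?f x = polyline p (x b)"
      unfolding walk_map_def Let_def S s using \<open>{u, v} \<in> edges T\<close> by simp
    ultimately show ?thesis
      using target.point_act_polyline[OF g p] source.point_act_act[OF g b] by simp
  qed
  have f_cont: "continuous_on (closed_edge T e) ?f" if e: "e \<in> edges T" for e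
  proof -
    obtain a b p where f: "\<forall>x\<in>closed_edge T e. ?f x = polyline p (x b)" using edge[OF e] by metis
    have "continuous_on (closed_edge T e) (\<lambda>x. x b)"
      by (rule continuous_on_product_then_coordinatewise[OF continuous_on_id])
    then have "continuous_on (closed_edge T e) (\<lambda>x. polyline p (x b))"
      by (rule continuous_polyline)
    then show ?thesis by (rule continuous_on_eq) (simp add: f)
  qed
  have f_segments: "\<exists>\<S>. finite \<S> \<and> \<Union>\<S> = closed_edge T e \<and>
        (\<forall>S\<in>\<S>. segment_in (closed_edge T e) S \<and> inj_on ?f S \<and> segment_in (realization T') (?f ` S))"
    if e: "e \<in> edges T" for e
  proof -
    obtain a b p where ab: "e = {a, b}" "{a, b} \<in> edges T" "a \<noteq> b" and p: "2 \<le> length p"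
      "successively (\<lambda>x y. {x, y} \<in> edges T') p"
      and f: "\<forall>x\<in>closed_edge T e. ?f x = polyline p (x b)" using edge[OF e] by metis
    define n where "n = length p - 1"
    have n: "0 < n" using p unfolding n_def by simp
    define h where "h i s = (real i + s) / real n" for i s
    define S where "S i = (\<lambda>s. edge_point a b (h i s)) ` {0..1}" for i
    have h: "0 \<le> h i s" "h i s \<le> 1" if "i < n" "s \<in> {0..1}" for i s
      using that n by (auto simp: h_def field_simps)
    have S_sub: "S i \<subseteq> closed_edge T e" if "i < n" for i
      using source.edge_point_closed_edge[OF ab(2)] h that unfolding S_def ab(1) by auto
    have union: "(\<Union>i<n. S i) = closed_edge T e"
    proof
      show "closed_edge T e \<subseteq> (\<Union>i<n. S i)"
      proof
        fix x assume "x \<in> closed_edge T e"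
        then obtain t where t: "0 \<le> t" "t \<le> 1" "x = edge_point a b t"
          using source.closed_edge_eq[OF ab(2)] ab(1) by auto
        obtain i s where i: "i < n" and s: "0 \<le> s" "s \<le> 1" "t = h i s"
          using unit_interval_subdivision[OF n t(1,2)] unfolding h_def by blast
        have "x \<in> S i" unfolding S_def t(3) s(3) using s by (intro imageI) simp
        then show "x \<in> (\<Union>i<n. S i)" using i by blast
      qed
    qed (use S_sub in auto)
    have segments: "segment_in (closed_edge T e) (S i) \<and> inj_on ?f (S i) \<and> segment_in (realization T') (?f ` S i)"
      if i: "i < n" for i
    proof -
      let ?a = "p ! i" and ?b = "p ! Suc i"
      have ab': "{?a, ?b} \<in> edges T'" using p i unfolding n_def by (simp add: successively_conv_nth)
      then have neq: "?a \<noteq> ?b" using target.edge_verts by blast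
      have f_eq: "?f (edge_point a b (h i s)) = edge_point ?a ?b s" if "s \<in> {0..1}" for s
      proof -
        have "edge_point a b (h i s) \<in> closed_edge T e" using S_sub[OF i] that unfolding S_def by blast
        then have "?f (edge_point a b (h i s)) = polyline p (h i s)"
          using f edge_point_target[OF ab(3)] by simp
        also have "\<dots> = edge_point ?a ?b s"
          unfolding h_def n_def using polyline_edge_point[of i p s] i that unfolding n_def by simp
        finally show ?thesis .
      qed
      have "arc (\<lambda>s. edge_point a b (h i s))"
        unfolding h_def using n by (intro arc_edge_point ab continuous_intros) (auto simp: inj_on_def)
      then have "segment_in (closed_edge T e) (S i)"
        using S_sub[OF i] unfolding segment_in_def S_def path_image_def by blast
      moreover have "inj_on ?f (S i)"
        unfolding S_def by (auto simp: inj_on_def f_eq edge_point_inject[OF neq])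
      moreover have "?f ` S i = edge_point ?a ?b ` {0..1}"
        unfolding S_def image_image using f_eq by simp
      moreover have "arc (edge_point ?a ?b)"
        using arc_edge_point[OF neq continuous_on_id] by simp
      then have "segment_in (realization T') (edge_point ?a ?b ` {0..1})"
        using target.edge_point_closed_edge[OF ab'] unfolding segment_in_def path_image_def closed_edge_def
        by (intro exI[of _ "edge_point ?a ?b"]) auto
      ultimately show ?thesis by simp
    qed
    show ?thesis
      by (rule exI[of _ "S ` {..<n}"]) (use union segments in auto)
  qed
  show ?thesis
    unfolding tree_morphism_def by (intro conjI ballI f_range f_act f_cont f_segments)
qed

section \<open>Comparison of the three conditions\<close>

lemma morphism_iff:
  "(\<exists>f. tree_morphism G T T' f) \<longleftrightarrow>
    (\<forall>e\<in>edges T. \<exists>e'\<in>edges T'. edge_stabilizer G T e \<subseteq> edge_stabilizer G T' e')"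
  using morphism_edge_stabilizer[OF source.G_tree_axioms target.G_tree_axioms]
    equivariant_edge_walks walk_map_morphism by blast

text \<open>Edge stabilizers are themselves bi-elliptic and contain all other bi-elliptic groups, so
  they decide the matter.\<close>

lemma bi_elliptic_transfer_iff:
  "(\<forall>H. bi_elliptic G T H \<longrightarrow> bi_elliptic G T' H) \<longleftrightarrow>
    (\<forall>e\<in>edges T. \<exists>e'\<in>edges T'. edge_stabilizer G T e \<subseteq> edge_stabilizer G T' e')"
  unfolding bi_elliptic_def using source.edge_stabilizer_subgroup by blast

text \<open>The upper bound on a generalized edge group is bi-ellipticity; the lower bound passes
  from \<open>T'\<close> to \<open>T\<close> by \<open>edge_stabilizer_contains\<close>, which
  dictates the direction. Conversely, each edge stabilizer is a generalized edge group.\<close>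

lemma generalized_edge_group_transfer_iff:
  "(\<forall>H. generalized_edge_group G T' H \<longrightarrow> generalized_edge_group G T H) \<longleftrightarrow>
    (\<forall>H. bi_elliptic G T' H \<longrightarrow> bi_elliptic G T H)"
proof
  assume gen: "\<forall>H. generalized_edge_group G T' H \<longrightarrow> generalized_edge_group G T H"
  show "\<forall>H. bi_elliptic G T' H \<longrightarrow> bi_elliptic G T H"
  proof (intro allI impI)
    fix H assume "bi_elliptic G T' H"
    then obtain e where e: "e \<in> edges T'" "subgroup H G" "H \<subseteq> edge_stabilizer G T' e"
      by (auto simp: bi_elliptic_def)
    then have "generalized_edge_group G T' (edge_stabilizer G T' e)"
      using target.edge_stabilizer_subgroup by (auto simp: generalized_edge_group_def)
    then have "generalized_edge_group G T (edge_stabilizer G T' e)" using gen by blast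
    then obtain e0 where "e0 \<in> edges T" "edge_stabilizer G T' e \<subseteq> edge_stabilizer G T e0"
      unfolding generalized_edge_group_def by blast
    then show "bi_elliptic G T H" unfolding bi_elliptic_def using e(2,3) by (meson subset_trans)
  qed
next
  assume bi: "\<forall>H. bi_elliptic G T' H \<longrightarrow> bi_elliptic G T H"
  show "\<forall>H. generalized_edge_group G T' H \<longrightarrow> generalized_edge_group G T H"
  proof (intro allI impI)
    fix H assume "generalized_edge_group G T' H"
    then obtain e where H: "bi_elliptic G T' H" and e: "e \<in> edges T'" "edge_stabilizer G T' e \<subseteq> H"
      unfolding generalized_edge_group_def bi_elliptic_def by blast
    obtain e0 where "e0 \<in> edges T" "edge_stabilizer G T e0 \<subseteq> H"
      using edge_stabilizer_contains[OF e(1)] e(2) by (meson subset_trans)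
    moreover have "bi_elliptic G T H" using bi H by blast
    ultimately show "generalized_edge_group G T H"
      unfolding generalized_edge_group_def bi_elliptic_def by blast
  qed
qed

end

theorem proposition4p7:
  fixes G :: "('a, 'm) monoid_scheme"
    and T :: "('a, 'v) gtree"
    and T' :: "('a, 'w) gtree"
  assumes "finitely_generated_group G"
    and "gtree G T"
    and "gtree G T'"
    and "same_deformation_space G T T'"
  shows "(morphisms_both_ways G T T' \<longleftrightarrow> same_generalized_edge_groups G T T') \<and>
         (same_generalized_edge_groups G T T' \<longleftrightarrow> same_bi_elliptic_groups G T T') \<and>
         (reduced G T \<and> reduced G T' \<longrightarrow>
            morphisms_both_ways G T T' \<and> same_generalized_edge_groups G T T' \<and>
            same_bi_elliptic_groups G T T')"
proof -
  have "group G" using assms(1) by (simp add: finitely_generated_group_def)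
  then have trees: "G_tree G T" "G_tree G T'" using assms(2,3)
    by (simp_all add: G_tree_def G_tree_axioms_def)
  have def_space: "same_deformation_space G T' T"
    using assms(4) by (simp add: same_deformation_space_def)
  obtain \<phi> where "vertex_map G T T' \<phi>" using vertex_map_exists[OF trees assms(4)] by blast
  then interpret forward: vertex_map G T T' \<phi> .
  obtain \<psi> where "vertex_map G T' T \<psi>" using vertex_map_exists[OF trees(2,1) def_space] by blast
  then interpret backward: vertex_map G T' T \<psi> .
  have bi: "same_bi_elliptic_groups G T T' \<longleftrightarrow>
      (\<forall>H. bi_elliptic G T H \<longrightarrow> bi_elliptic G T' H) \<and> (\<forall>H. bi_elliptic G T' H \<longrightarrow> bi_elliptic G T H)"
    unfolding same_bi_elliptic_groups_def by blast
  have "morphisms_both_ways G T T' \<longleftrightarrow> same_bi_elliptic_groups G T T'"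
    unfolding bi morphisms_both_ways_def forward.morphism_iff backward.morphism_iff
      forward.bi_elliptic_transfer_iff backward.bi_elliptic_transfer_iff by blast
  \<comment> \<open>The roles cross here: \<open>forward\<close> governs the transfer from
    \<open>T'\<close> to \<open>T\<close>, and \<open>backward\<close> the one from \<open>T\<close>
    to \<open>T'\<close>.\<close>
  moreover have "same_generalized_edge_groups G T T' \<longleftrightarrow> same_bi_elliptic_groups G T T'"
    unfolding bi same_generalized_edge_groups_def
      forward.generalized_edge_group_transfer_iff[symmetric] backward.generalized_edge_group_transfer_iff[symmetric]
    by blast
  moreover have "same_bi_elliptic_groups G T T'" if "reduced G T" "reduced G T'"
    unfolding bi forward.bi_elliptic_transfer_iff backward.bi_elliptic_transfer_iff
    using reduced_edge_stabilizer_bi_elliptic[OF trees assms(4) that(1)]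
      reduced_edge_stabilizer_bi_elliptic[OF trees(2,1) def_space that(2)]
    by (auto simp: bi_elliptic_def)
  ultimately show ?thesis by blast
qed

end
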